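(* If $\Delta$ is a simple polytope that contains no pervasive facets, then every mass linear function on $\Delta$ is inessential.
   Context: Let $\mathfrak t$ be a finite-dimensional real vector space with dual $\mathfrak t^*$ and pairing $\langle\cdot,\cdot\rangle$. A polytope is a bounded set $\Delta=\bigcap_{i=1}^N\{x\in\mathfrak t^*\mid\langle\eta_i,x\rangle\le\kappa_i\}$ with outward conormals $\eta_i\in\mathfrak t$ and support numbers $\kappa_i\in\mathbb R$, where $\Delta$ affinely spans $\mathfrak t^*$ and each facet $F_i=\Delta\cap\{\langle\eta_i,x\rangle=\kappa_i\}$ affinely spans a hyperplane. It is simple if exactly $\dim\mathfrak t$ facets meet at each vertex. A facet is pervasive if it has nonempty intersection with every other facet of $\Delta$. With the $\eta_i$ fixed, for $\kappa'\in\mathbb R^N$ let $\Delta(\kappa')=\bigcap_i\{\langle\eta_i,x\rangle\le\kappa'_i\}$, with facets $F_i(\kappa')$. The chamber $\mathcal C_\Delta\subset\mathbb R^N$ is the connected component containing $\kappa$ of the set of $\kappa'$ for which $\Delta(\kappa')$ is a simple polytope (with $N$ facets, that is, $\Delta(\kappa')$ affinely spans $\mathfrak t^*$, each of the $N$ sets $\Delta(\kappa')\cap\{\langle\eta_i,x\rangle=\kappa'_i\}$ affinely spans a hyperplane, and exactly $\dim\mathfrak t$ of these $N$ facets meet at each vertex). $c_\Delta(\kappa')$ is the center of mass of $\Delta(\kappa')$. An affine function $H:\mathfrak t^*\to\mathbb R$ is mass linear on $\Delta$ if there are constants $\gamma_i,C\in\mathbb R$ with $H(c_\Delta(\kappa'))=\sum_i\gamma_i\kappa'_i+C$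 for all $\kappa'\in\mathcal C_\Delta$; in particular this applies to $H\in\mathfrak t$. A symmetry of a polytope is an affine map $a:\mathfrak t^*\to\mathfrak t^*$ taking the polytope to itself. A robust symmetry of $\Delta$ is a linear map $\hat a:\mathfrak t^*\to\mathfrak t^*$ such that for every $\kappa'\in\mathcal C_\Delta$ there is a symmetry $a_{\kappa'}$ of $\Delta(\kappa')$ with associated linear map $\hat a$. Facets $F_i$, $F_j$ are equivalent if there is a robust symmetry $\hat a$ such that each $a_{\kappa'}$ takes $F_i(\kappa')$ to $F_j(\kappa')$; the classes are viewed as subsets of $\{1,\dots,N\}$. The conormals are normalized so that for every robust symmetry $\hat a$ and every $i$ there is $j$ with $\hat a^*(\eta_i)=\eta_j$ (this is always possible). $H\in\mathfrak t$ is inessential if $H=\sum_i\beta_i\eta_i$ with $\beta_i\in\mathbb R$ and $\sum_{i\in I}\beta_i=0$ for every equivalence class $I$; an affine function is inessential if its linear part is. *)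

theory Defs
  imports "HOL-Analysis.Analysis"
begin

text \<open>
  Both \<open>t\<close> and its dual are rendered as one Euclidean space \<open>'a\<close>, the pairing being the inner
  product; under this identification the dual map of \<open>L\<close> is \<^term>\<open>adjoint L\<close>. The index set
  \<open>{1,\<dots>,N}\<close> is the finite type \<open>'n\<close>, so that support numbers live in \<^typ>\<open>real ^ 'n\<close>.
\<close>

definition Delta :: "('n::finite \<Rightarrow> 'a::euclidean_space) \<Rightarrow> real ^ 'n \<Rightarrow> 'a set" where
  "Delta \<eta> \<kappa> = (\<Inter>i. {x. \<eta> i \<bullet> x \<le> \<kappa> $ i})"

definition facet :: "('n::finite \<Rightarrow> 'a::euclidean_space) \<Rightarrow> real ^ 'n \<Rightarrow> 'n \<Rightarrow> 'a set" where
  "facet \<eta> \<kappa> i = Delta \<eta> \<kappa> \<inter> {x. \<eta> i \<bullet> x = \<kappa> $ i}"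

definition affinely_spans_hyperplane :: "'a::euclidean_space set \<Rightarrow> bool" where
  "affinely_spans_hyperplane S \<longleftrightarrow> (\<exists>a b. a \<noteq> 0 \<and> affine hull S = {x. a \<bullet> x = b})"

definition is_polytope :: "('n::finite \<Rightarrow> 'a::euclidean_space) \<Rightarrow> real ^ 'n \<Rightarrow> bool" where
  "is_polytope \<eta> \<kappa> \<longleftrightarrow>
     bounded (Delta \<eta> \<kappa>) \<and> affine hull (Delta \<eta> \<kappa>) = UNIV \<and>
     (\<forall>i. affinely_spans_hyperplane (facet \<eta> \<kappa> i))"

text \<open>
  Facets through a vertex are counted by index. A facet listed twice would put more than
  \<open>DIM('a)\<close> indices at each of its vertices, so the facets of a simple polytope are distinct.
\<close>

definition simple_polytope :: "('n::finite \<Rightarrow> 'a::euclidean_space) \<Rightarrow> real ^ 'n \<Rightarrow> bool" where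
  "simple_polytope \<eta> \<kappa> \<longleftrightarrow>
     is_polytope \<eta> \<kappa> \<and>
     (\<forall>v. v extreme_point_of Delta \<eta> \<kappa> \<longrightarrow> card {i. v \<in> facet \<eta> \<kappa> i} = DIM('a))"

definition pervasive_facet :: "('n::finite \<Rightarrow> 'a::euclidean_space) \<Rightarrow> real ^ 'n \<Rightarrow> 'n \<Rightarrow> bool" where
  "pervasive_facet \<eta> \<kappa> i \<longleftrightarrow> (\<forall>j. j \<noteq> i \<longrightarrow> facet \<eta> \<kappa> i \<inter> facet \<eta> \<kappa> j \<noteq> {})"

definition chamber :: "('n::finite \<Rightarrow> 'a::euclidean_space) \<Rightarrow> real ^ 'n \<Rightarrow> (real ^ 'n) set" where
  "chamber \<eta> \<kappa> = connected_component_set {\<kappa>'. simple_polytope \<eta> \<kappa>'} \<kappa>"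

definition center_of_mass :: "'a::euclidean_space set \<Rightarrow> 'a" where
  "center_of_mass S = (LINT x:S|lborel. x) /\<^sub>R measure lborel S"

definition affine_with_linear_part ::
    "('a::real_vector \<Rightarrow> 'b::real_vector) \<Rightarrow> ('a \<Rightarrow> 'b) \<Rightarrow> bool" where
  "affine_with_linear_part f L \<longleftrightarrow> linear L \<and> (\<exists>c. \<forall>x. f x = L x + c)"

definition mass_linear ::
    "('n::finite \<Rightarrow> 'a::euclidean_space) \<Rightarrow> real ^ 'n \<Rightarrow> ('a \<Rightarrow> real) \<Rightarrow> bool" where
  "mass_linear \<eta> \<kappa> H \<longleftrightarrow>
     (\<exists>L. affine_with_linear_part H L) \<and>
     (\<exists>(\<gamma> :: 'n \<Rightarrow> real) C. \<forall>\<kappa>' \<in> chamber \<eta> \<kappa>.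
        H (center_of_mass (Delta \<eta> \<kappa>')) = (\<Sum>i\<in>UNIV. \<gamma> i * \<kappa>' $ i) + C)"

definition symmetry_of :: "('a::real_vector \<Rightarrow> 'a) \<Rightarrow> 'a set \<Rightarrow> bool" where
  "symmetry_of a S \<longleftrightarrow> (\<exists>L. affine_with_linear_part a L) \<and> a ` S = S"

definition robust_symmetry ::
    "('n::finite \<Rightarrow> 'a::euclidean_space) \<Rightarrow> real ^ 'n \<Rightarrow> ('a \<Rightarrow> 'a) \<Rightarrow> bool" where
  "robust_symmetry \<eta> \<kappa> L \<longleftrightarrow>
     linear L \<and>
     (\<forall>\<kappa>' \<in> chamber \<eta> \<kappa>. \<exists>a. symmetry_of a (Delta \<eta> \<kappa>') \<and> affine_with_linear_part a L)"

text \<open>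
  A symmetry of a polytope fixes the center of mass and is therefore determined by its linear
  part, so the inner universal quantifier ranges over exactly one map.
\<close>

definition equivalent_facets ::
    "('n::finite \<Rightarrow> 'a::euclidean_space) \<Rightarrow> real ^ 'n \<Rightarrow> 'n \<Rightarrow> 'n \<Rightarrow> bool" where
  "equivalent_facets \<eta> \<kappa> i j \<longleftrightarrow>
     (\<exists>L. robust_symmetry \<eta> \<kappa> L \<and>
        (\<forall>\<kappa>' \<in> chamber \<eta> \<kappa>. \<forall>a.
           symmetry_of a (Delta \<eta> \<kappa>') \<and> affine_with_linear_part a L \<longrightarrow>
           a ` facet \<eta> \<kappa>' i = facet \<eta> \<kappa>' j))"

definition facet_classes ::
    "('n::finite \<Rightarrow> 'a::euclidean_space) \<Rightarrow> real ^ 'n \<Rightarrow> 'n set set" where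
  "facet_classes \<eta> \<kappa> = UNIV // {(i, j). equivalent_facets \<eta> \<kappa> i j}"

definition normalized_conormals ::
    "('n::finite \<Rightarrow> 'a::euclidean_space) \<Rightarrow> real ^ 'n \<Rightarrow> bool" where
  "normalized_conormals \<eta> \<kappa> \<longleftrightarrow>
     (\<forall>L. robust_symmetry \<eta> \<kappa> L \<longrightarrow> (\<forall>i. \<exists>j. adjoint L (\<eta> i) = \<eta> j))"

definition inessential_vector ::
    "('n::finite \<Rightarrow> 'a::euclidean_space) \<Rightarrow> real ^ 'n \<Rightarrow> 'a \<Rightarrow> bool" where
  "inessential_vector \<eta> \<kappa> h \<longleftrightarrow>
     (\<exists>\<beta> :: 'n \<Rightarrow> real. h = (\<Sum>i\<in>UNIV. \<beta> i *\<^sub>R \<eta> i) \<and>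
        (\<forall>I \<in> facet_classes \<eta> \<kappa>. (\<Sum>i\<in>I. \<beta> i) = 0))"

definition inessential ::
    "('n::finite \<Rightarrow> 'a::euclidean_space) \<Rightarrow> real ^ 'n \<Rightarrow> ('a \<Rightarrow> real) \<Rightarrow> bool" where
  "inessential \<eta> \<kappa> H \<longleftrightarrow>
     (\<exists>h. affine_with_linear_part H (\<lambda>x. h \<bullet> x) \<and> inessential_vector \<eta> \<kappa> h)"

end

theory Submission
  imports Defs
begin

text \<open>
  Write \<open>V \<kappa>\<close> for the volume of \<open>Delta \<eta> \<kappa>\<close> and let \<open>H\<close> be mass linear with linear part \<open>h\<close> and
  coefficients \<open>\<gamma>\<close>. Translating the polytope gives \<open>h = (\<Sum>k. \<gamma> k *\<^sub>R \<eta> k)\<close>, so it suffices to show that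
  the numbers \<open>\<gamma> k\<close> add up to zero on each equivalence class of facets. Call a facet asymmetric if
  \<open>\<gamma> i \<noteq> 0\<close>. The argument shows that an asymmetric facet \<open>F i\<close> which misses another facet \<open>F j\<close> is
  interchanged with \<open>F j\<close> by a robust reflection, and that \<open>\<gamma> i + \<gamma> j = 0\<close>; when no facet is pervasive
  the asymmetric facets are thus paired off inside their classes.

  The analytic input is additivity of volume and first moment and comparison of volumes, with finite
  differences instead of derivatives. The
  iterated difference of \<open>V\<close> in the directions of a set \<open>S\<close> of indices is the volume of the set
  \<open>slab \<eta> \<kappa> S s\<close> of points which lie beyond the walls in \<open>S\<close> by at most \<open>s\<close>. If \<open>F i\<close> and \<open>F j\<close> are
  disjoint, volume and first moment are both additive under moving the two walls; together with
  mass linearity this gives \<open>\<gamma> i * D\<^sub>j V + \<gamma> j * D\<^sub>i V = 0\<close> near \<open>\<kappa>\<close>, and hence the same identity for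
  all further differences (\<open>moment_exchange\<close>). Consequently, if \<open>F i\<close> is asymmetric, \<open>\<gamma> i\<close> and \<open>\<gamma> j\<close> have opposite signs, and
  since \<open>D\<^sub>i D\<^sub>j V = 0\<close>, also \<open>D\<^sub>i D\<^sub>i V = 0\<close>.

  Localizing the last equation to an edge of \<open>F i\<close> says that a thin slab along that edge keeps its
  volume when it is pushed across \<open>F i\<close>. Comparing the two slabs by a translation shows that the
  edges which leave \<open>F i\<close> at the two ends are parallel (\<open>flat_edge\<close>). Walking along edges of \<open>F i\<close> as in
  the simplex algorithm, one finds a single direction \<open>\<xi>\<close> tangent to all facets that meet \<open>F i\<close>
  (\<open>flat_facet\<close>). The signs of the \<open>\<gamma> k\<close> leave \<open>F j\<close> as the only facet disjoint from \<open>F i\<close>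
  (\<open>asymmetric_facet_direction\<close>), so the polytope is a cylinder in direction \<open>\<xi>\<close> cut off by \<open>F i\<close> and
  \<open>F j\<close>. Reflecting each fibre in its midpoint is a robust symmetry exchanging the two ends
  (\<open>reflection_robust_symmetry\<close>). Normalization of the conormals makes \<open>\<xi>\<close> cross \<open>F i\<close> and \<open>F j\<close> at
  the same rate, and then the exchange identity yields \<open>\<gamma> i + \<gamma> j = 0\<close>.
\<close>

section \<open>Vertices of simple polytopes\<close>

lemma mem_Delta: "x \<in> Delta \<eta> \<kappa> \<longleftrightarrow> (\<forall>i. \<eta> i \<bullet> x \<le> \<kappa> $ i)"
  by (simp add: Delta_def)

lemma mem_facet: "x \<in> facet \<eta> \<kappa> i \<longleftrightarrow> x \<in> Delta \<eta> \<kappa> \<and> \<eta> i \<bullet> x = \<kappa> $ i"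
  by (simp add: facet_def)

lemma convex_Delta: "convex (Delta \<eta> \<kappa>)"
  unfolding Delta_def by (intro convex_INT) (simp add: convex_halfspace_le)

lemma closed_Delta: "closed (Delta \<eta> \<kappa>)"
  unfolding Delta_def by (intro closed_INT) (simp add: closed_halfspace_le)

text \<open>
  The indices of the inequalities that hold with equality at \<open>x\<close>. For \<open>x \<in> Delta \<eta> \<kappa>\<close> these are the
  facets through \<open>x\<close>.
\<close>

definition active :: "('n::finite \<Rightarrow> 'a::euclidean_space) \<Rightarrow> real ^ 'n \<Rightarrow> 'a \<Rightarrow> 'n set" where
  "active \<eta> \<kappa> x = {i. \<eta> i \<bullet> x = \<kappa> $ i}"

lemma slack_radius:
  fixes \<eta> :: "'n::finite \<Rightarrow> 'a::euclidean_space"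
  assumes "\<And>k. k \<in> K \<Longrightarrow> \<eta> k \<bullet> x < \<kappa> $ k"
  obtains t where "t > 0" "\<And>s k. \<bar>s\<bar> \<le> t \<Longrightarrow> k \<in> K \<Longrightarrow> \<eta> k \<bullet> (x + s *\<^sub>R y) < \<kappa> $ k"
proof -
  have "\<forall>\<^sub>F s in at 0. \<forall>k\<in>K. \<eta> k \<bullet> (x + s *\<^sub>R y) < \<kappa> $ k"
  proof (rule eventually_ball_finite, simp, rule ballI)
    fix k assume "k \<in> K"
    have "((\<lambda>s. \<eta> k \<bullet> (x + s *\<^sub>R y)) \<longlongrightarrow> \<eta> k \<bullet> (x + 0 *\<^sub>R y)) (at 0)"
      by (intro tendsto_intros)
    then show "\<forall>\<^sub>F s in at 0. \<eta> k \<bullet> (x + s *\<^sub>R y) < \<kappa> $ k"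
      using assms[OF \<open>k \<in> K\<close>] by (intro order_tendstoD(2)) auto
  qed
  then obtain d where d: "d > 0" "\<And>s. s \<noteq> 0 \<Longrightarrow> dist s 0 < d \<Longrightarrow> \<forall>k\<in>K. \<eta> k \<bullet> (x + s *\<^sub>R y) < \<kappa> $ k"
    unfolding eventually_at by auto
  show thesis
  proof (rule that[of "d/2"])
    show "d/2 > 0" using d by simp
    fix s k assume "\<bar>s\<bar> \<le> d/2" "k \<in> K"
    then show "\<eta> k \<bullet> (x + s *\<^sub>R y) < \<kappa> $ k"
      using d assms by (cases "s = 0") (auto simp: dist_real_def)
  qed
qed

lemma active_normals_separate_extreme_point:
  fixes \<eta> :: "'n::finite \<Rightarrow> 'a::euclidean_space"
  assumes v: "v extreme_point_of Delta \<eta> \<kappa>" and y: "\<And>l. l \<in> active \<eta> \<kappa> v \<Longrightarrow> \<eta> l \<bullet> y = 0"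
  shows "y = 0"
proof (rule ccontr)
  assume "y \<noteq> 0"
  have vD: "v \<in> Delta \<eta> \<kappa>" using v by (simp add: extreme_point_of_def)
  obtain t where t: "t > 0"
    "\<And>s k. \<bar>s\<bar> \<le> t \<Longrightarrow> k \<in> - active \<eta> \<kappa> v \<Longrightarrow> \<eta> k \<bullet> (v + s *\<^sub>R y) < \<kappa> $ k"
    using vD by (auto intro: slack_radius[of "- active \<eta> \<kappa> v" \<eta> v \<kappa> y]
        simp: active_def mem_Delta less_le)
  have in_D: "v + s *\<^sub>R y \<in> Delta \<eta> \<kappa>" if "\<bar>s\<bar> \<le> t" for s
    unfolding mem_Delta
  proof
    fix k
    show "\<eta> k \<bullet> (v + s *\<^sub>R y) \<le> \<kappa> $ k"
      using t(2)[OF that, of k] y[of k]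
      by (cases "k \<in> active \<eta> \<kappa> v") (auto simp: active_def inner_add_right)
  qed
  have "v \<in> open_segment (v + (-t) *\<^sub>R y) (v + t *\<^sub>R y)"
    using t(1) \<open>y \<noteq> 0\<close> unfolding in_segment
    by (auto simp: algebra_simps scaleR_2[symmetric] intro!: exI[of _ "1/2"])
  with in_D[of "-t"] in_D[of t] t(1) v show False
    by (auto simp: extreme_point_of_def)
qed

lemma extreme_point_if_separated:
  fixes \<eta> :: "'n::finite \<Rightarrow> 'a::euclidean_space"
  assumes v: "v \<in> Delta \<eta> \<kappa>" and sep: "\<And>y. (\<And>l. l \<in> active \<eta> \<kappa> v \<Longrightarrow> \<eta> l \<bullet> y = 0) \<Longrightarrow> y = 0"
  shows "v extreme_point_of Delta \<eta> \<kappa>"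
  unfolding extreme_point_of_def
proof (intro conjI ballI notI v)
  fix a b assume ab: "a \<in> Delta \<eta> \<kappa>" "b \<in> Delta \<eta> \<kappa>" and "v \<in> open_segment a b"
  then obtain u where u: "0 < u" "u < 1" "v = (1 - u) *\<^sub>R a + u *\<^sub>R b" and "a \<noteq> b"
    by (auto simp: in_segment)
  have "a - b = 0"
  proof (rule sep)
    fix l assume l: "l \<in> active \<eta> \<kappa> v"
    have "(1 - u) * (\<kappa> $ l - \<eta> l \<bullet> a) + u * (\<kappa> $ l - \<eta> l \<bullet> b) = 0"
      using l u(3) by (auto simp: active_def algebra_simps)
    moreover have "\<eta> l \<bullet> a \<le> \<kappa> $ l" "\<eta> l \<bullet> b \<le> \<kappa> $ l" using ab by (auto simp: mem_Delta)
    ultimately have "(1 - u) * (\<kappa> $ l - \<eta> l \<bullet> a) = 0" "u * (\<kappa> $ l - \<eta> l \<bullet> b) = 0"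
      using u by (smt (verit) mult_nonneg_nonneg)+
    then show "\<eta> l \<bullet> (a - b) = 0" using u by (simp add: inner_diff_right)
  qed
  with \<open>a \<noteq> b\<close> show False by simp
qed

lemma span_UNIV_if_separates:
  fixes B :: "'a::euclidean_space set"
  assumes "\<And>y. (\<And>b. b \<in> B \<Longrightarrow> b \<bullet> y = 0) \<Longrightarrow> y = 0"
  shows "span B = UNIV"
proof (rule ccontr)
  assume "span B \<noteq> UNIV"
  then obtain a where "a \<noteq> 0" "\<forall>x \<in> span B. a \<bullet> x = 0"
    using span_not_UNIV_orthogonal by metis
  with assms[of a] show False by (metis inner_commute span_base)
qed

text \<open>
  The vectors \<open>d p\<close>, \<open>p \<in> T\<close>, form the basis dual to the basis \<open>\<eta> p\<close>, \<open>p \<in> T\<close>. At a vertex of a simple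
  polytope with active set \<open>T\<close>, the edges leave in the directions \<open>- d p\<close>. Values of \<open>d\<close> outside \<open>T\<close> are
  arbitrary.
\<close>

definition dual_frame :: "('n \<Rightarrow> 'a::euclidean_space) \<Rightarrow> 'n set \<Rightarrow> ('n \<Rightarrow> 'a) \<Rightarrow> bool" where
  "dual_frame \<eta> T d \<longleftrightarrow>
     (\<forall>p\<in>T. \<forall>l\<in>T. \<eta> l \<bullet> d p = (if l = p then 1 else 0)) \<and>
     (\<forall>y. (\<forall>l\<in>T. \<eta> l \<bullet> y = 0) \<longrightarrow> y = 0)"

lemma dual_frame_exists:
  fixes \<eta> :: "'n::finite \<Rightarrow> 'a::euclidean_space"
  assumes card: "card T \<le> DIM('a)" and sep: "\<And>y. (\<And>l. l \<in> T \<Longrightarrow> \<eta> l \<bullet> y = 0) \<Longrightarrow> y = 0"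
  obtains d where "dual_frame \<eta> T d"
proof -
  have sp: "span (\<eta> ` T) = UNIV" by (rule span_UNIV_if_separates) (auto intro: sep)
  have "DIM('a) \<le> card (\<eta> ` T)"
    using dim_le_card[of UNIV "\<eta> ` T"] sp by (simp add: dim_UNIV)
  then have c: "card (\<eta> ` T) = card T" "card (\<eta> ` T) = DIM('a)"
    using card card_image_le[of T \<eta>] by auto
  then have inj: "inj_on \<eta> T" by (simp add: eq_card_imp_inj_on)
  have indep: "independent (\<eta> ` T)"
    by (rule card_le_dim_spanning[of _ UNIV]) (use sp c in \<open>auto simp: dim_UNIV\<close>)
  have "\<exists>d. \<forall>l\<in>T. \<eta> l \<bullet> d = (if l = p then 1 else 0)" if "p \<in> T" for p
  proof -
    obtain g :: "'a \<Rightarrow> real" where g: "linear g" "\<forall>x\<in>\<eta> ` T. g x = (if x = \<eta> p then 1 else 0)"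
      using linear_independent_extend[OF indep, of "\<lambda>x. if x = \<eta> p then 1 else 0"] by blast
    have "g x = x \<bullet> adjoint g 1" for x using adjoint_works[OF g(1), of x 1] by simp
    then show ?thesis
      using g(2) inj that by (intro exI[of _ "adjoint g 1"]) (auto simp: inj_on_def)
  qed
  then obtain d where "\<forall>p\<in>T. \<forall>l\<in>T. \<eta> l \<bullet> d p = (if l = p then 1 else 0)" by metis
  then show thesis using sep by (intro that[of d]) (auto simp: dual_frame_def)
qed

lemma separated_card:
  fixes \<eta> :: "'n::finite \<Rightarrow> 'a::euclidean_space"
  assumes "\<And>y. (\<And>l. l \<in> T \<Longrightarrow> \<eta> l \<bullet> y = 0) \<Longrightarrow> y = 0"
  shows "DIM('a) \<le> card T"
proof -
  have "span (\<eta> ` T) = UNIV" by (rule span_UNIV_if_separates) (auto intro: assms)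
  then have "DIM('a) \<le> card (\<eta> ` T)" using dim_le_card[of UNIV "\<eta> ` T"] by (simp add: dim_UNIV)
  then show ?thesis using card_image_le[of T \<eta>] by auto
qed

lemma dual_frame_eqI:
  assumes "dual_frame \<eta> T d" "\<And>l. l \<in> T \<Longrightarrow> \<eta> l \<bullet> x = \<eta> l \<bullet> y"
  shows "x = y"
proof -
  have "x - y = 0" using assms unfolding dual_frame_def by (metis inner_diff_right right_minus_eq)
  then show ?thesis by simp
qed

lemma dual_frame_inner:
  "dual_frame \<eta> T d \<Longrightarrow> p \<in> T \<Longrightarrow> l \<in> T \<Longrightarrow> \<eta> l \<bullet> d p = (if l = p then 1 else 0)"
  by (auto simp: dual_frame_def)

lemma dual_frame_inner_sum:
  fixes \<eta> :: "'n::finite \<Rightarrow> 'a::euclidean_space"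
  assumes "dual_frame \<eta> T d" "l \<in> T"
  shows "\<eta> l \<bullet> (\<Sum>p\<in>T. c p *\<^sub>R d p) = c l"
proof -
  have "\<eta> l \<bullet> (\<Sum>p\<in>T. c p *\<^sub>R d p) = (\<Sum>p\<in>T. if l = p then c p else 0)"
    unfolding inner_sum_right
    by (rule sum.cong[OF refl]) (use assms in \<open>simp add: dual_frame_inner\<close>)
  also have "\<dots> = c l" using assms by simp
  finally show ?thesis .
qed

lemma dual_frame_expand:
  fixes \<eta> :: "'n::finite \<Rightarrow> 'a::euclidean_space"
  assumes "dual_frame \<eta> T d"
  shows "y = (\<Sum>p\<in>T. (\<eta> p \<bullet> y) *\<^sub>R d p)"
  by (rule dual_frame_eqI[OF assms]) (simp add: dual_frame_inner_sum[OF assms])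

lemma card_active_eq_DIM:
  fixes \<eta> :: "'n::finite \<Rightarrow> 'a::euclidean_space"
  assumes "simple_polytope \<eta> \<kappa>" "v extreme_point_of Delta \<eta> \<kappa>"
  shows "card (active \<eta> \<kappa> v) = DIM('a)"
proof -
  have "v \<in> Delta \<eta> \<kappa>" using assms by (simp add: extreme_point_of_def)
  then have "{i. v \<in> facet \<eta> \<kappa> i} = active \<eta> \<kappa> v" by (auto simp: mem_facet active_def)
  then show ?thesis using assms unfolding simple_polytope_def by metis
qed

lemma simple_polytope_vertex_frame:
  fixes \<eta> :: "'n::finite \<Rightarrow> 'a::euclidean_space"
  assumes "simple_polytope \<eta> \<kappa>" "v extreme_point_of Delta \<eta> \<kappa>"
  obtains d where "dual_frame \<eta> (active \<eta> \<kappa> v) d"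
  by (rule dual_frame_exists[of "active \<eta> \<kappa> v" \<eta>])
    (use card_active_eq_DIM[OF assms] active_normals_separate_extreme_point[OF assms(2)] that in auto)

text \<open>
  At a vertex whose active conormals form a basis, a small step can change the values of the active
  inequalities at prescribed rates, while all others stay strict.
\<close>

lemma vertex_neighbour:
  fixes \<eta> :: "'n::finite \<Rightarrow> 'a::euclidean_space"
  assumes fr: "dual_frame \<eta> T d" and T: "T = active \<eta> \<kappa> v" and v: "v \<in> Delta \<eta> \<kappa>"
  obtains t where "t > 0"
    "\<And>s k. \<bar>s\<bar> \<le> t \<Longrightarrow> k \<notin> T \<Longrightarrow> \<eta> k \<bullet> (v + s *\<^sub>R (\<Sum>p\<in>T. c p *\<^sub>R d p)) < \<kappa> $ k"
    "\<And>s l. l \<in> T \<Longrightarrow> \<eta> l \<bullet> (v + s *\<^sub>R (\<Sum>p\<in>T. c p *\<^sub>R d p)) = \<kappa> $ l + s * c l"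
proof -
  have "\<eta> k \<bullet> v < \<kappa> $ k" if "k \<in> - T" for k
    using that v by (auto simp: T active_def mem_Delta less_le)
  then obtain t where t: "t > 0"
    "\<And>s k. \<bar>s\<bar> \<le> t \<Longrightarrow> k \<in> - T \<Longrightarrow> \<eta> k \<bullet> (v + s *\<^sub>R (\<Sum>p\<in>T. c p *\<^sub>R d p)) < \<kappa> $ k"
    using slack_radius[of "- T" \<eta> v \<kappa> "\<Sum>p\<in>T. c p *\<^sub>R d p"] by blast
  show thesis
  proof (rule that[OF t(1)])
    show "\<eta> l \<bullet> (v + s *\<^sub>R (\<Sum>p\<in>T. c p *\<^sub>R d p)) = \<kappa> $ l + s * c l" if "l \<in> T" for s l
      using that dual_frame_inner_sum[OF fr that, of c] by (simp add: inner_add_right) (simp add: T active_def)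
  qed (use t(2) in auto)
qed

lemma vertex_on_face:
  fixes \<eta> :: "'n::finite \<Rightarrow> 'a::euclidean_space"
  assumes bd: "bounded (Delta \<eta> \<kappa>)" and x: "x \<in> Delta \<eta> \<kappa>" "T \<subseteq> active \<eta> \<kappa> x"
  obtains v where "v extreme_point_of Delta \<eta> \<kappa>" "T \<subseteq> active \<eta> \<kappa> v"
proof -
  let ?D = "Delta \<eta> \<kappa>"
  define F where "F = ?D \<inter> (\<Inter>i\<in>T. ?D \<inter> {x. \<eta> i \<bullet> x = \<kappa> $ i})"
  have face: "F face_of ?D"
  proof (cases "T = {}")
    case True then show ?thesis by (simp add: F_def face_of_refl convex_Delta)
  next
    case False
    have "(\<Inter>i\<in>T. ?D \<inter> {x. \<eta> i \<bullet> x = \<kappa> $ i}) face_of ?D"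
      using False
      by (intro face_of_Inter)
        (auto intro!: face_of_Int_supporting_hyperplane_le convex_Delta simp: mem_Delta)
    moreover have "F = (\<Inter>i\<in>T. ?D \<inter> {x. \<eta> i \<bullet> x = \<kappa> $ i})" using False by (auto simp: F_def)
    ultimately show ?thesis by simp
  qed
  have "compact F"
    by (meson bd closed_Delta compact_eq_bounded_closed convex_Delta face face_of_imp_compact)
  moreover have "x \<in> F" using x by (auto simp: F_def active_def)
  ultimately obtain v where v: "v extreme_point_of F"
    using extreme_point_exists_convex[of F] face_of_imp_convex[OF face] by auto
  show thesis
  proof (rule that)
    show "v extreme_point_of ?D" using v face extreme_point_of_face by blast
    have "v \<in> F" using v by (simp add: extreme_point_of_def)
    then have "\<eta> i \<bullet> v = \<kappa> $ i" if "i \<in> T" for i using that unfolding F_def by blast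
    then show "T \<subseteq> active \<eta> \<kappa> v" unfolding active_def by blast
  qed
qed

lemma simple_facet_nonempty:
  assumes "simple_polytope \<eta> \<kappa>"
  shows "facet \<eta> \<kappa> i \<noteq> {}"
proof
  assume e: "facet \<eta> \<kappa> i = {}"
  obtain a b where ab: "a \<noteq> 0" "affine hull (facet \<eta> \<kappa> i) = {x. a \<bullet> x = b}"
    using assms unfolding simple_polytope_def is_polytope_def affinely_spans_hyperplane_def by blast
  have "(b / (a \<bullet> a)) *\<^sub>R a \<in> {x. a \<bullet> x = b}" using ab by simp
  with ab e show False by simp
qed

lemma simple_facet_vertex:
  fixes \<eta> :: "'n::finite \<Rightarrow> 'a::euclidean_space"
  assumes "simple_polytope \<eta> \<kappa>"
  obtains v where "v extreme_point_of Delta \<eta> \<kappa>" "i \<in> active \<eta> \<kappa> v"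
proof -
  obtain x where "x \<in> facet \<eta> \<kappa> i" using simple_facet_nonempty[OF assms] by blast
  then show thesis
    using that vertex_on_face[of \<eta> \<kappa> x "{i}"] assms
    by (auto simp: simple_polytope_def is_polytope_def mem_facet active_def)
qed

section \<open>Stability under changes of the support numbers\<close>

lemma simple_polytope_bounded: "simple_polytope \<eta> \<kappa> \<Longrightarrow> bounded (Delta \<eta> \<kappa>)"
  by (simp add: simple_polytope_def is_polytope_def)

lemma simple_polytope_nonempty:
  assumes "simple_polytope \<eta> \<kappa>"
  shows "Delta \<eta> \<kappa> \<noteq> {}"
proof
  assume "Delta \<eta> \<kappa> = {}"
  then have "affine hull (Delta \<eta> \<kappa>) = {}" by simp
  with assms show False by (simp add: simple_polytope_def is_polytope_def)
qed

lemma recession_direction_zero: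
  fixes \<eta> :: "'n::finite \<Rightarrow> 'a::euclidean_space"
  assumes "bounded (Delta \<eta> \<kappa>)" "Delta \<eta> \<kappa> \<noteq> {}" and y: "\<And>k. \<eta> k \<bullet> y \<le> 0"
  shows "y = 0"
proof (rule ccontr)
  assume "y \<noteq> 0"
  obtain x where x: "x \<in> Delta \<eta> \<kappa>" using assms by blast
  obtain b where b: "\<And>z. z \<in> Delta \<eta> \<kappa> \<Longrightarrow> norm z \<le> b" using assms(1) by (auto simp: bounded_iff)
  define t where "t = (b + norm x + 1) / norm y"
  have "b \<ge> 0" using b[OF x] norm_ge_zero order_trans by blast
  then have t: "t \<ge> 0" "norm (t *\<^sub>R y) = b + norm x + 1" using \<open>y \<noteq> 0\<close> by (auto simp: t_def)
  have "x + t *\<^sub>R y \<in> Delta \<eta> \<kappa>" unfolding mem_Delta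
  proof
    fix k
    have "t * (\<eta> k \<bullet> y) \<le> 0" using t(1) y[of k] by (simp add: mult_nonneg_nonpos)
    then show "\<eta> k \<bullet> (x + t *\<^sub>R y) \<le> \<kappa> $ k" using x by (auto simp: mem_Delta inner_add_right intro: order_trans[rotated])
  qed
  from b[OF this] t(2) norm_diff_ineq[of "t *\<^sub>R y" x] show False by (simp add: add.commute)
qed

text \<open>
  The function on the right is positive on the unit sphere because a bounded polytope has no
  recession direction; it therefore dominates a multiple of the norm.
\<close>

lemma coercive_support_sum:
  fixes \<eta> :: "'n::finite \<Rightarrow> 'a::euclidean_space"
  assumes "bounded (Delta \<eta> \<kappa>)" "Delta \<eta> \<kappa> \<noteq> {}"
  obtains \<delta> where "\<delta> > 0" "\<And>x. \<delta> * norm x \<le> (\<Sum>k\<in>UNIV. max 0 (\<eta> k \<bullet> x))"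
proof -
  let ?g = "\<lambda>x. \<Sum>k\<in>UNIV. max 0 (\<eta> k \<bullet> x)"
  obtain b :: 'a where "b \<in> Basis" using nonempty_Basis by blast
  then have "sphere (0::'a) 1 \<noteq> {}" by (auto intro!: exI[of _ b] simp: ex_in_conv[symmetric])
  moreover have "continuous_on (sphere (0::'a) 1) ?g"
    by (intro continuous_intros continuous_on_max)
  ultimately obtain z where z: "z \<in> sphere 0 1" "\<And>y. y \<in> sphere 0 1 \<Longrightarrow> ?g z \<le> ?g y"
    using continuous_attains_inf[of "sphere (0::'a) 1" ?g] compact_sphere by blast
  have pos: "?g z > 0"
  proof (rule ccontr)
    assume "\<not> ?g z > 0"
    then have "?g z = 0" by (smt (verit) sum_nonneg)
    then have "\<eta> k \<bullet> z \<le> 0" for k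
      by (subst (asm) sum_nonneg_eq_0_iff) (auto simp: max_def split: if_splits dest!: spec[of _ k])
    then have "z = 0" by (rule recession_direction_zero[OF assms])
    with z show False by simp
  qed
  show thesis
  proof (rule that[OF pos])
    fix x
    show "?g z * norm x \<le> ?g x"
    proof (cases "x = 0")
      case False
      have "?g z \<le> ?g (x /\<^sub>R norm x)" using False by (intro z) simp
      then have "?g z * norm x \<le> ?g (x /\<^sub>R norm x) * norm x" by (intro mult_right_mono) auto
      also have "\<dots> = (\<Sum>k\<in>UNIV. max 0 (\<eta> k \<bullet> (x /\<^sub>R norm x)) * norm x)"
        by (simp add: sum_distrib_right)
      also have "\<dots> = ?g x"
        using False by (intro sum.cong refl) (auto simp: max_def field_simps zero_le_mult_iff mult_le_0_iff)
      finally show ?thesis .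
    qed simp
  qed
qed

lemma bounded_Delta_all:
  fixes \<eta> :: "'n::finite \<Rightarrow> 'a::euclidean_space"
  assumes "bounded (Delta \<eta> \<kappa>)" "Delta \<eta> \<kappa> \<noteq> {}"
  shows "bounded (Delta \<eta> \<kappa>')"
proof -
  obtain \<delta> where d: "\<delta> > 0" "\<And>x. \<delta> * norm x \<le> (\<Sum>k\<in>UNIV. max 0 (\<eta> k \<bullet> x))"
    using coercive_support_sum[OF assms] by blast
  have "norm x \<le> (\<Sum>k\<in>UNIV. max 0 (\<kappa>' $ k)) / \<delta>" if "x \<in> Delta \<eta> \<kappa>'" for x
  proof -
    have "(\<Sum>k\<in>UNIV. max 0 (\<eta> k \<bullet> x)) \<le> (\<Sum>k\<in>UNIV. max 0 (\<kappa>' $ k))"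
      using that by (intro sum_mono max.mono) (auto simp: mem_Delta)
    with d(2)[of x] d(1) show ?thesis by (simp add: field_simps)
  qed
  then show ?thesis by (auto simp: bounded_iff)
qed

lemma simple_polytope_bounded_all: "simple_polytope \<eta> \<kappa> \<Longrightarrow> bounded (Delta \<eta> \<kappa>')"
  by (rule bounded_Delta_all[OF simple_polytope_bounded simple_polytope_nonempty])

text \<open>
  \<open>\<epsilon>\<close> is so small that inequalities which are simultaneously within \<open>\<epsilon>\<close> of being active at a point
  that violates no inequality by more than \<open>\<epsilon>\<close> are simultaneously active at some point of the
  polytope. Perturbing the support numbers by less than \<open>\<epsilon>\<close> creates no new intersections of facets.
\<close>

definition stable_radius ::
    "('n::finite \<Rightarrow> 'a::euclidean_space) \<Rightarrow> real ^ 'n \<Rightarrow> real \<Rightarrow> bool" where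
  "stable_radius \<eta> \<kappa> \<epsilon> \<longleftrightarrow> \<epsilon> > 0 \<and>
     (\<forall>x T. (\<forall>k. \<eta> k \<bullet> x \<le> \<kappa> $ k + \<epsilon>) \<and> (\<forall>k\<in>T. \<kappa> $ k - \<epsilon> \<le> \<eta> k \<bullet> x) \<longrightarrow>
        (\<exists>z\<in>Delta \<eta> \<kappa>. T \<subseteq> active \<eta> \<kappa> z))"

lemma stable_radius_mono:
  assumes "stable_radius \<eta> \<kappa> \<epsilon>" "0 < \<epsilon>'" "\<epsilon>' \<le> \<epsilon>"
  shows "stable_radius \<eta> \<kappa> \<epsilon>'"
  unfolding stable_radius_def
proof (intro conjI allI impI)
  fix x T
  assume "(\<forall>k. \<eta> k \<bullet> x \<le> \<kappa> $ k + \<epsilon>') \<and> (\<forall>k\<in>T. \<kappa> $ k - \<epsilon>' \<le> \<eta> k \<bullet> x)"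
  with assms(3) have "(\<forall>k. \<eta> k \<bullet> x \<le> \<kappa> $ k + \<epsilon>) \<and> (\<forall>k\<in>T. \<kappa> $ k - \<epsilon> \<le> \<eta> k \<bullet> x)"
    by (smt (verit))
  with assms(1) show "\<exists>z\<in>Delta \<eta> \<kappa>. T \<subseteq> active \<eta> \<kappa> z" unfolding stable_radius_def by blast
qed (use assms in simp)

lemma stable_radiusD:
  assumes "stable_radius \<eta> \<kappa> \<epsilon>" "\<And>k. \<eta> k \<bullet> x \<le> \<kappa> $ k + \<epsilon>" "\<And>k. k \<in> T \<Longrightarrow> \<kappa> $ k - \<epsilon> \<le> \<eta> k \<bullet> x"
  obtains z where "z \<in> Delta \<eta> \<kappa>" "T \<subseteq> active \<eta> \<kappa> z"
  using assms unfolding stable_radius_def by blast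

lemma stable_radius_exists:
  fixes \<eta> :: "'n::finite \<Rightarrow> 'a::euclidean_space"
  assumes "bounded (Delta \<eta> \<kappa>)" "Delta \<eta> \<kappa> \<noteq> {}"
  obtains \<epsilon> where "stable_radius \<eta> \<kappa> \<epsilon>"
proof -
  obtain \<delta> where d: "\<delta> > 0" "\<And>x. \<delta> * norm x \<le> (\<Sum>k\<in>UNIV. max 0 (\<eta> k \<bullet> x))"
    using coercive_support_sum[OF assms] by blast
  have "\<exists>e>0. (\<exists>x. (\<forall>k. \<eta> k \<bullet> x \<le> \<kappa> $ k + e) \<and> (\<forall>k\<in>T. \<kappa> $ k - e \<le> \<eta> k \<bullet> x)) \<longrightarrow>
        (\<exists>z\<in>Delta \<eta> \<kappa>. T \<subseteq> active \<eta> \<kappa> z)" for T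
  proof (rule ccontr)
    assume neg: "\<not> ?thesis"
    then have no: "\<not> (\<exists>z\<in>Delta \<eta> \<kappa>. T \<subseteq> active \<eta> \<kappa> z)" using zero_less_one by blast
    have "\<exists>x. (\<forall>k. \<eta> k \<bullet> x \<le> \<kappa> $ k + 1 / real (Suc m)) \<and>
              (\<forall>k\<in>T. \<kappa> $ k - 1 / real (Suc m) \<le> \<eta> k \<bullet> x)" for m
      using neg no by (metis of_nat_0_less_iff zero_less_Suc zero_less_divide_1_iff)
    then obtain X where X: "\<And>m k. \<eta> k \<bullet> X m \<le> \<kappa> $ k + 1 / real (Suc m)"
      "\<And>m k. k \<in> T \<Longrightarrow> \<kappa> $ k - 1 / real (Suc m) \<le> \<eta> k \<bullet> X m"
      by metis
    \<comment> \<open>Points violating the property for \<open>1 / Suc m\<close> accumulate at a point where all of \<open>T\<close> is active.\<close>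
    have "norm (X m) \<le> (\<Sum>k\<in>UNIV. max 0 (\<kappa> $ k + 1)) / \<delta>" for m
    proof -
      have "\<eta> k \<bullet> X m \<le> \<kappa> $ k + 1" for k
        using X(1)[of k m] by (smt (verit) divide_le_eq_1 of_nat_0_less_iff of_nat_Suc of_nat_0_le_iff)
      then have "(\<Sum>k\<in>UNIV. max 0 (\<eta> k \<bullet> X m)) \<le> (\<Sum>k\<in>UNIV. max 0 (\<kappa> $ k + 1))"
        by (intro sum_mono max.mono) auto
      with d(2)[of "X m"] d(1) show ?thesis by (simp add: field_simps)
    qed
    then have "bounded (range X)" by (auto simp: bounded_iff)
    then obtain x r where r: "strict_mono r" "(X \<circ> r) \<longlonglongrightarrow> x"
      using bounded_imp_convergent_subsequence by metis
    have lim: "(\<lambda>m. \<eta> k \<bullet> X (r m)) \<longlonglongrightarrow> \<eta> k \<bullet> x" for k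
      using r(2) unfolding comp_def by (intro tendsto_intros)
    have eps: "(\<lambda>m. 1 / real (Suc (r m))) \<longlonglongrightarrow> 0"
      using LIMSEQ_subseq_LIMSEQ[OF LIMSEQ_Suc[OF lim_1_over_n] r(1)] by (simp add: comp_def)
    have le: "\<eta> k \<bullet> x \<le> \<kappa> $ k" for k
      using LIMSEQ_le[OF lim[of k] tendsto_add[OF tendsto_const eps, of "\<kappa> $ k"]] X(1) by simp
    have "\<kappa> $ k \<le> \<eta> k \<bullet> x" if "k \<in> T" for k
      using LIMSEQ_le[OF tendsto_diff[OF tendsto_const eps, of "\<kappa> $ k"] lim[of k]] X(2)[OF that] by simp
    with le have "x \<in> Delta \<eta> \<kappa>" "T \<subseteq> active \<eta> \<kappa> x"
      by (auto simp: mem_Delta active_def intro: antisym)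
    with no show False by blast
  qed
  then obtain e where e: "\<And>T. e T > 0"
    "\<And>T x. (\<forall>k. \<eta> k \<bullet> x \<le> \<kappa> $ k + e T) \<Longrightarrow> (\<forall>k\<in>T. \<kappa> $ k - e T \<le> \<eta> k \<bullet> x) \<Longrightarrow>
        (\<exists>z\<in>Delta \<eta> \<kappa>. T \<subseteq> active \<eta> \<kappa> z)"
    by metis
  define \<epsilon> where "\<epsilon> = Min (range e)"
  have le: "\<epsilon> \<le> e T" for T by (simp add: \<epsilon>_def)
  have "\<epsilon> > 0" using e(1) by (simp add: \<epsilon>_def)
  moreover have "\<exists>z\<in>Delta \<eta> \<kappa>. T \<subseteq> active \<eta> \<kappa> z"
    if "\<forall>k. \<eta> k \<bullet> x \<le> \<kappa> $ k + \<epsilon>" "\<forall>k\<in>T. \<kappa> $ k - \<epsilon> \<le> \<eta> k \<bullet> x" for x T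
  proof (rule e(2))
    show "\<forall>k. \<eta> k \<bullet> x \<le> \<kappa> $ k + e T" using that(1) le[of T] by (smt (verit))
    show "\<forall>k\<in>T. \<kappa> $ k - e T \<le> \<eta> k \<bullet> x" using that(2) le[of T] by (smt (verit))
  qed
  ultimately show thesis by (intro that[of \<epsilon>]) (auto simp: stable_radius_def)
qed

lemma facet_interior_point:
  fixes \<eta> :: "'n::finite \<Rightarrow> 'a::euclidean_space"
  assumes "simple_polytope \<eta> \<kappa>"
  obtains x e where "\<eta> i \<bullet> x = \<kappa> $ i" "\<And>k. k \<noteq> i \<Longrightarrow> \<eta> k \<bullet> x < \<kappa> $ k" "\<eta> i \<bullet> e = 1"
proof -
  obtain v where v: "v extreme_point_of Delta \<eta> \<kappa>" "i \<in> active \<eta> \<kappa> v"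
    using simple_facet_vertex[OF assms] by blast
  obtain d where fr: "dual_frame \<eta> (active \<eta> \<kappa> v) d"
    using simple_polytope_vertex_frame[OF assms v(1)] .
  have vD: "v \<in> Delta \<eta> \<kappa>" using v by (simp add: extreme_point_of_def)
  obtain t where t: "t > 0"
    "\<And>s k. \<bar>s\<bar> \<le> t \<Longrightarrow> k \<notin> active \<eta> \<kappa> v \<Longrightarrow>
       \<eta> k \<bullet> (v + s *\<^sub>R (\<Sum>p\<in>active \<eta> \<kappa> v. (if p = i then 0 else -1) *\<^sub>R d p)) < \<kappa> $ k"
    "\<And>s l. l \<in> active \<eta> \<kappa> v \<Longrightarrow>
       \<eta> l \<bullet> (v + s *\<^sub>R (\<Sum>p\<in>active \<eta> \<kappa> v. (if p = i then 0 else -1) *\<^sub>R d p)) =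
       \<kappa> $ l + s * (if l = i then 0 else -1)"
    using vertex_neighbour[OF fr refl vD, of "\<lambda>p. if p = i then 0 else -1"] by blast
  let ?x = "v + t *\<^sub>R (\<Sum>p\<in>active \<eta> \<kappa> v. (if p = i then 0 else -1) *\<^sub>R d p)"
  show thesis
  proof (rule that)
    show "\<eta> i \<bullet> ?x = \<kappa> $ i" using t(3)[OF v(2), of t] by simp
    show "\<eta> k \<bullet> ?x < \<kappa> $ k" if "k \<noteq> i" for k
      using t(1) t(2)[of t k] t(3)[of k t] that by (cases "k \<in> active \<eta> \<kappa> v") auto
    show "\<eta> i \<bullet> d i = 1" using dual_frame_inner[OF fr v(2) v(2)] by simp
  qed
qed

lemma eventually_simple_polytope:
  fixes \<eta> :: "'n::finite \<Rightarrow> 'a::euclidean_space"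
  assumes simple: "simple_polytope \<eta> \<kappa>"
  shows "\<forall>\<^sub>F \<kappa>' in nhds \<kappa>. simple_polytope \<eta> \<kappa>'"
proof -
  note bd = simple_polytope_bounded[OF simple] and ne = simple_polytope_nonempty[OF simple]
  obtain \<epsilon> where \<epsilon>: "stable_radius \<eta> \<kappa> \<epsilon>" using stable_radius_exists[OF bd ne] .
  \<comment> \<open>As the wall \<open>i\<close> moves, its interior point \<open>X i\<close> follows along the transversal direction \<open>E i\<close>.\<close>
  have "\<exists>x e. \<eta> i \<bullet> x = \<kappa> $ i \<and> (\<forall>k. k \<noteq> i \<longrightarrow> \<eta> k \<bullet> x < \<kappa> $ k) \<and> \<eta> i \<bullet> e = 1" for i
    using facet_interior_point[OF simple, of i] by metis
  then obtain X E where X: "\<And>i. \<eta> i \<bullet> X i = \<kappa> $ i" "\<And>i k. k \<noteq> i \<Longrightarrow> \<eta> k \<bullet> X i < \<kappa> $ k"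
    and E: "\<And>i. \<eta> i \<bullet> E i = 1" by metis
  have "\<forall>\<^sub>F \<kappa>' in nhds \<kappa>. \<forall>k\<in>UNIV. \<bar>\<kappa>' $ k - \<kappa> $ k\<bar> < \<epsilon>"
  proof (rule eventually_ball_finite, simp, rule ballI)
    fix k
    have "open {\<kappa>'::real^'n. \<bar>\<kappa>' $ k - \<kappa> $ k\<bar> < \<epsilon>}" by (intro open_Collect_less continuous_intros)
    then show "\<forall>\<^sub>F \<kappa>' in nhds \<kappa>. \<bar>\<kappa>' $ k - \<kappa> $ k\<bar> < \<epsilon>"
      using \<epsilon> unfolding eventually_nhds by (intro exI[of _ "{\<kappa>'. \<bar>\<kappa>' $ k - \<kappa> $ k\<bar> < \<epsilon>}"]) (auto simp: stable_radius_def)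
  qed
  moreover have "\<forall>\<^sub>F \<kappa>' in nhds \<kappa>. \<forall>i\<in>UNIV. \<forall>k\<in>UNIV-{i}. \<eta> k \<bullet> (X i + (\<kappa>' $ i - \<kappa> $ i) *\<^sub>R E i) < \<kappa>' $ k"
  proof (intro eventually_ball_finite finite_Diff ballI)
    fix i k :: 'n assume "k \<in> UNIV - {i}"
    let ?S = "{\<kappa>'::real^'n. \<eta> k \<bullet> (X i + (\<kappa>' $ i - \<kappa> $ i) *\<^sub>R E i) < \<kappa>' $ k}"
    have "open ?S" by (intro open_Collect_less continuous_intros)
    moreover have "\<kappa> \<in> ?S" using X(2)[of k i] \<open>k \<in> UNIV - {i}\<close> by simp
    ultimately show "\<forall>\<^sub>F \<kappa>' in nhds \<kappa>. \<eta> k \<bullet> (X i + (\<kappa>' $ i - \<kappa> $ i) *\<^sub>R E i) < \<kappa>' $ k"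
      unfolding eventually_nhds by blast
  qed simp_all
  ultimately show ?thesis
  proof eventually_elim
    case (elim \<kappa>')
    have near: "\<bar>\<kappa>' $ k - \<kappa> $ k\<bar> < \<epsilon>" for k using elim(1) by simp
    define Y where "Y i = X i + (\<kappa>' $ i - \<kappa> $ i) *\<^sub>R E i" for i
    have Y: "\<eta> i \<bullet> Y i = \<kappa>' $ i" "k \<noteq> i \<Longrightarrow> \<eta> k \<bullet> Y i < \<kappa>' $ k" for i k
      using elim(2) X E by (auto simp: Y_def inner_add_right)
    have nz: "\<eta> i \<noteq> 0" for i using E[of i] by auto
    have facets: "affine hull (facet \<eta> \<kappa>' i) = {x. \<eta> i \<bullet> x = \<kappa>' $ i}" for i :: 'n
    proof (rule antisym)
      show "affine hull (facet \<eta> \<kappa>' i) \<subseteq> {x. \<eta> i \<bullet> x = \<kappa>' $ i}"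
        by (rule hull_minimal) (auto simp: mem_facet intro: affine_hyperplane)
      let ?U = "\<Inter>k\<in>-{i::'n}. {x. \<eta> k \<bullet> x < \<kappa>' $ k}"
      have "Y i \<in> ?U" using Y(2)[of _ i] by simp
      then have ne: "{x. \<eta> i \<bullet> x = \<kappa>' $ i} \<inter> ?U \<noteq> {}" using Y(1)[of i] by (metis (mono_tags) IntI emptyE mem_Collect_eq)
      have op: "open ?U" by (intro open_INT ballI open_halfspace_lt) simp
      have "affine hull ({x. \<eta> i \<bullet> x = \<kappa>' $ i} \<inter> ?U) = affine hull {x. \<eta> i \<bullet> x = \<kappa>' $ i}"
        by (rule affine_hull_affine_Int_open[OF affine_hyperplane op ne])
      then have eq: "{x. \<eta> i \<bullet> x = \<kappa>' $ i} \<subseteq> affine hull ({x. \<eta> i \<bullet> x = \<kappa>' $ i} \<inter> ?U)"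
        by (simp only: hull_subset)
      have "{x. \<eta> i \<bullet> x = \<kappa>' $ i} \<inter> ?U \<subseteq> facet \<eta> \<kappa>' i"
      proof
        fix x assume x: "x \<in> {x. \<eta> i \<bullet> x = \<kappa>' $ i} \<inter> ?U"
        have "\<eta> k \<bullet> x \<le> \<kappa>' $ k" for k
        proof (cases "k = i")
          case False
          then have "\<eta> k \<bullet> x < \<kappa>' $ k" using x by simp
          then show ?thesis by simp
        qed (use x in simp)
        then show "x \<in> facet \<eta> \<kappa>' i" using x by (simp add: mem_facet mem_Delta)
      qed
      then have "affine hull ({x. \<eta> i \<bullet> x = \<kappa>' $ i} \<inter> ?U) \<subseteq> affine hull facet \<eta> \<kappa>' i"
        by (rule hull_mono)
      from eq this show "{x. \<eta> i \<bullet> x = \<kappa>' $ i} \<subseteq> affine hull (facet \<eta> \<kappa>' i)"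
        by (rule subset_trans)
    qed
    have "is_polytope \<eta> \<kappa>'"
      unfolding is_polytope_def
    proof (intro conjI allI)
      show "bounded (Delta \<eta> \<kappa>')" by (rule bounded_Delta_all[OF bd ne])
      show "affinely_spans_hyperplane (facet \<eta> \<kappa>' i)" for i
        unfolding affinely_spans_hyperplane_def using facets[of i] nz[of i] by auto
      show "affine hull Delta \<eta> \<kappa>' = UNIV"
      proof -
        fix i :: 'n
        let ?U = "\<Inter>k::'n. {x. \<eta> k \<bullet> x < \<kappa>' $ k}"
        obtain t where t: "t > 0" "\<And>s k. \<bar>s\<bar> \<le> t \<Longrightarrow> k \<in> -{i} \<Longrightarrow> \<eta> k \<bullet> (Y i + s *\<^sub>R E i) < \<kappa>' $ k"
          using slack_radius[of "-{i}" \<eta> "Y i" \<kappa>' "E i"] Y(2) by auto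
        have "\<eta> k \<bullet> (Y i + (-t) *\<^sub>R E i) < \<kappa>' $ k" for k
          using t(1) t(2)[of "-t" k] Y(1)[of i] E[of i]
          by (cases "k = i") (auto simp: inner_diff_right)
        then have "Y i + (-t) *\<^sub>R E i \<in> ?U" by simp
        moreover have "open ?U" by (intro open_INT ballI open_halfspace_lt) simp
        ultimately have "affine hull ?U = UNIV" using affine_hull_open[of ?U] by blast
        moreover have "?U \<subseteq> Delta \<eta> \<kappa>'" by (simp add: mem_Delta subset_iff order_less_imp_le)
        ultimately show ?thesis using hull_mono[of ?U "Delta \<eta> \<kappa>'" affine] by auto
      qed
    qed
    moreover have "card {i. v \<in> facet \<eta> \<kappa>' i} = DIM('a)" if v: "v extreme_point_of Delta \<eta> \<kappa>'" for v
    proof -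
      have vD: "v \<in> Delta \<eta> \<kappa>'" using v by (simp add: extreme_point_of_def)
      then have eq: "{i. v \<in> facet \<eta> \<kappa>' i} = active \<eta> \<kappa>' v" by (auto simp: mem_facet active_def)
      have le: "\<eta> k \<bullet> v \<le> \<kappa> $ k + \<epsilon>" for k
      proof -
        have "\<eta> k \<bullet> v \<le> \<kappa>' $ k" using vD by (simp add: mem_Delta)
        with near[of k] show ?thesis by linarith
      qed
      have ge: "\<kappa> $ k - \<epsilon> \<le> \<eta> k \<bullet> v" if "k \<in> active \<eta> \<kappa>' v" for k
        using that near[of k] by (auto simp: active_def)
      obtain z where z: "z \<in> Delta \<eta> \<kappa>" "active \<eta> \<kappa>' v \<subseteq> active \<eta> \<kappa> z"
        using stable_radiusD[OF \<epsilon> le ge] by blast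
      \<comment> \<open>The facets through \<open>v\<close> also meet in \<open>Delta \<eta> \<kappa>\<close>, at a point \<open>z\<close> which is then a simple vertex.\<close>
      note sep = active_normals_separate_extreme_point[OF v]
      have "z extreme_point_of Delta \<eta> \<kappa>"
        by (rule extreme_point_if_separated[OF z(1)]) (rule sep, use z(2) in auto)
      moreover have "{i. z \<in> facet \<eta> \<kappa> i} = active \<eta> \<kappa> z" using z by (auto simp: mem_facet active_def)
      ultimately have "card (active \<eta> \<kappa> z) = DIM('a)"
        using simple unfolding simple_polytope_def by metis
      moreover have "DIM('a) \<le> card (active \<eta> \<kappa>' v)" by (rule separated_card) (rule sep)
      ultimately show ?thesis using card_mono[OF _ z(2)] eq by simp
    qed
    ultimately show ?case by (simp add: simple_polytope_def)
  qed
qed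

lemma chamber_contains_box:
  fixes \<eta> :: "'n::finite \<Rightarrow> 'a::euclidean_space"
  assumes simple: "simple_polytope \<eta> \<kappa>"
  obtains \<epsilon> where "\<epsilon> > 0" "\<And>\<kappa>'. (\<And>k. \<bar>\<kappa>' $ k - \<kappa> $ k\<bar> \<le> \<epsilon>) \<Longrightarrow> \<kappa>' \<in> chamber \<eta> \<kappa>"
proof -
  obtain e where e: "e > 0" "\<And>\<kappa>'. dist \<kappa>' \<kappa> < e \<Longrightarrow> simple_polytope \<eta> \<kappa>'"
    using eventually_simple_polytope[OF simple] unfolding eventually_nhds_metric by blast
  have ball: "ball \<kappa> e \<subseteq> chamber \<eta> \<kappa>"
    unfolding chamber_def
    by (rule connected_component_maximal) (use e in \<open>auto simp: dist_commute\<close>)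
  define \<epsilon> where "\<epsilon> = e / (2 * real CARD('n))"
  have pos: "\<epsilon> > 0" using e by (simp add: \<epsilon>_def)
  show thesis
  proof (rule that[OF pos])
    fix \<kappa>' :: "real ^ 'n" assume near: "\<And>k. \<bar>\<kappa>' $ k - \<kappa> $ k\<bar> \<le> \<epsilon>"
    have "norm (\<kappa> - \<kappa>') \<le> (\<Sum>k\<in>UNIV. \<bar>(\<kappa> - \<kappa>') $ k\<bar>)" by (rule norm_le_l1_cart)
    also have "\<dots> \<le> real CARD('n) * \<epsilon>"
      using sum_bounded_above[of UNIV "\<lambda>k. \<bar>(\<kappa> - \<kappa>') $ k\<bar>" \<epsilon>] near by (simp add: abs_minus_commute)
    also have "\<dots> < e" using e by (simp add: \<epsilon>_def)
    finally show "\<kappa>' \<in> chamber \<eta> \<kappa>" using ball by (auto simp: dist_norm)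
  qed
qed

lemma simple_polytope_chamber: "\<kappa>' \<in> chamber \<eta> \<kappa> \<Longrightarrow> simple_polytope \<eta> \<kappa>'"
  using connected_component_subset[of "{\<kappa>'. simple_polytope \<eta> \<kappa>'}" \<kappa>] by (auto simp: chamber_def)

section \<open>Slabs and the exchange identity\<close>

text \<open>
  Points that lie beyond the walls in \<open>S\<close>, each by at most \<open>s\<close>, and satisfy all other inequalities.
  By inclusion and exclusion (\<open>slab_insert\<close>) its volume is the iterated difference, with step \<open>s\<close> in the
  directions of \<open>S\<close>, of the volume of \<open>Delta \<eta> \<kappa>\<close>.
\<close>

definition slab ::
    "('n::finite \<Rightarrow> 'a::euclidean_space) \<Rightarrow> real ^ 'n \<Rightarrow> 'n set \<Rightarrow> real \<Rightarrow> 'a set" where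
  "slab \<eta> \<kappa> S s = {x. \<forall>k. if k \<in> S then \<kappa> $ k < \<eta> k \<bullet> x \<and> \<eta> k \<bullet> x \<le> \<kappa> $ k + s
                              else \<eta> k \<bullet> x \<le> \<kappa> $ k}"

lemma slab_empty [simp]: "slab \<eta> \<kappa> {} s = Delta \<eta> \<kappa>"
  by (auto simp: slab_def mem_Delta)

lemma Delta_translate:
  "(+) w ` Delta \<eta> \<kappa> = Delta \<eta> (\<chi> k. \<kappa> $ k + \<eta> k \<bullet> w)"
proof (intro set_eqI iffI)
  fix x assume "x \<in> Delta \<eta> (\<chi> k. \<kappa> $ k + \<eta> k \<bullet> w)"
  then have "x - w \<in> Delta \<eta> \<kappa>" by (auto simp: mem_Delta inner_diff_right diff_le_eq)
  then show "x \<in> (+) w ` Delta \<eta> \<kappa>" by (intro image_eqI[of _ _ "x - w"]) auto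
qed (auto simp: mem_Delta inner_add_right add.commute)

lemma measure_pos_if_open_subset:
  fixes A :: "'a::euclidean_space set"
  assumes "A \<in> lmeasurable" "open U" "U \<noteq> {}" "U \<subseteq> A"
  shows "measure lebesgue A > 0"
proof -
  obtain x r where r: "r > 0" "ball x r \<subseteq> U" using assms by (meson all_not_in_conv openE)
  have "0 < measure lebesgue (ball x r)" using r(1) by (simp add: content_ball_pos)
  also have "\<dots> \<le> measure lebesgue A"
    using r(2) assms by (intro measure_mono_fmeasurable) auto
  finally show ?thesis .
qed

lemma measure_translate_strict_subset:
  fixes A B :: "'a::euclidean_space set"
  assumes A: "A \<in> lmeasurable" and B: "B \<in> lmeasurable" and sub: "(+) w ` A \<subseteq> B"
    and U: "open U" "U \<noteq> {}" "U \<subseteq> B - (+) w ` A"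
  shows "measure lebesgue A < measure lebesgue B"
proof -
  have A': "(+) w ` A \<in> lmeasurable" using A by (rule measurable_translation)
  have "0 < measure lebesgue (B - (+) w ` A)"
    using A' B U by (intro measure_pos_if_open_subset[OF _ U]) (auto intro: fmeasurable.Diff)
  also have "\<dots> = measure lebesgue B - measure lebesgue ((+) w ` A)"
    using A' B sub by (intro measurable_measure_Diff) auto
  finally show ?thesis by (simp add: measure_translation)
qed

text \<open>
  The equation \<open>h \<bullet> center_of_mass (Delta \<eta> \<kappa>) = (\<Sum>k. \<gamma> k * \<kappa> $ k) + c\<close> with the volume cleared from the
  denominator, so that both sides are built from additive set functions.
\<close>

definition moment_identity ::
    "('n::finite \<Rightarrow> 'a::euclidean_space) \<Rightarrow> 'a \<Rightarrow> real \<Rightarrow> ('n \<Rightarrow> real) \<Rightarrow> real ^ 'n \<Rightarrow> bool" where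
  "moment_identity \<eta> h c \<gamma> \<kappa> \<longleftrightarrow>
     h \<bullet> (LINT x:Delta \<eta> \<kappa>|lborel. x) =
     ((\<Sum>k\<in>UNIV. \<gamma> k * \<kappa> $ k) + c) * measure lebesgue (Delta \<eta> \<kappa>)"

context
  fixes \<eta> :: "'n::finite \<Rightarrow> 'a::euclidean_space"
  assumes bd: "\<And>\<kappa>. bounded (Delta \<eta> \<kappa>)"
begin

lemma compact_Delta: "compact (Delta \<eta> \<kappa>)"
  using bd closed_Delta compact_eq_bounded_closed by blast

lemma slab_lmeasurable:
  assumes "s \<ge> 0"
  shows "slab \<eta> \<kappa> S s \<in> lmeasurable"
proof (rule bounded_set_imp_lmeasurable)
  have "slab \<eta> \<kappa> S s \<subseteq> Delta \<eta> (\<chi> k. \<kappa> $ k + s)"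
    using assms unfolding slab_def mem_Delta subset_iff by (auto split: if_splits) (smt (verit))+
  then show "bounded (slab \<eta> \<kappa> S s)" using bd bounded_subset by blast
  have "slab \<eta> \<kappa> S s = (\<Inter>k. if k \<in> S then {x. \<kappa> $ k < \<eta> k \<bullet> x} \<inter> {x. \<eta> k \<bullet> x \<le> \<kappa> $ k + s}
                                  else {x. \<eta> k \<bullet> x \<le> \<kappa> $ k})"
    by (auto simp: slab_def)
  also have "\<dots> \<in> sets borel" by (intro sets.countable_INT'') auto
  finally show "slab \<eta> \<kappa> S s \<in> sets lebesgue" by simp
qed

lemma slab_insert:
  assumes "l \<notin> S" "s \<ge> 0"
  shows "measure lebesgue (slab \<eta> (\<kappa> + axis l s) S s) =
         measure lebesgue (slab \<eta> \<kappa> S s) + measure lebesgue (slab \<eta> \<kappa> (insert l S) s)"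
proof -
  have "slab \<eta> (\<kappa> + axis l s) S s = slab \<eta> \<kappa> S s \<union> slab \<eta> \<kappa> (insert l S) s"
  proof (intro set_eqI iffI)
    fix x assume x: "x \<in> slab \<eta> (\<kappa> + axis l s) S s"
    then have *: "if k \<in> S then \<kappa> $ k < \<eta> k \<bullet> x \<and> \<eta> k \<bullet> x \<le> \<kappa> $ k + s else \<eta> k \<bullet> x \<le> \<kappa> $ k"
      if "k \<noteq> l" for k using that by (auto simp: slab_def axis_def dest: spec[of _ k])
    have l: "\<eta> l \<bullet> x \<le> \<kappa> $ l + s"
      using x assms(1) by (auto simp: slab_def axis_def dest: spec[of _ l])
    show "x \<in> slab \<eta> \<kappa> S s \<union> slab \<eta> \<kappa> (insert l S) s"
    proof (cases "\<eta> l \<bullet> x \<le> \<kappa> $ l")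
      case True
      have "x \<in> slab \<eta> \<kappa> S s" unfolding slab_def mem_Collect_eq
      proof
        fix k show "if k \<in> S then \<kappa> $ k < \<eta> k \<bullet> x \<and> \<eta> k \<bullet> x \<le> \<kappa> $ k + s else \<eta> k \<bullet> x \<le> \<kappa> $ k"
          using *[of k] True assms(1) by (cases "k = l") auto
      qed
      then show ?thesis by blast
    next
      case False
      have "x \<in> slab \<eta> \<kappa> (insert l S) s" unfolding slab_def mem_Collect_eq
      proof
        fix k show "if k \<in> insert l S then \<kappa> $ k < \<eta> k \<bullet> x \<and> \<eta> k \<bullet> x \<le> \<kappa> $ k + s
                    else \<eta> k \<bullet> x \<le> \<kappa> $ k"
          using *[of k] False l by (cases "k = l") auto
      qed
      then show ?thesis by blast
    qed
  next
    fix x assume "x \<in> slab \<eta> \<kappa> S s \<union> slab \<eta> \<kappa> (insert l S) s"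
    then have x: "\<And>k. if k \<in> S then \<kappa> $ k < \<eta> k \<bullet> x \<and> \<eta> k \<bullet> x \<le> \<kappa> $ k + s
                    else if k = l then \<eta> k \<bullet> x \<le> \<kappa> $ k + s else \<eta> k \<bullet> x \<le> \<kappa> $ k"
      using assms unfolding slab_def by (auto split: if_splits)
    show "x \<in> slab \<eta> (\<kappa> + axis l s) S s" unfolding slab_def mem_Collect_eq
    proof
      fix k show "if k \<in> S then (\<kappa> + axis l s) $ k < \<eta> k \<bullet> x \<and> \<eta> k \<bullet> x \<le> (\<kappa> + axis l s) $ k + s
                  else \<eta> k \<bullet> x \<le> (\<kappa> + axis l s) $ k"
        using x[of k] assms(1) by (cases "k = l") (auto simp: axis_def)
    qed
  qed
  moreover have "slab \<eta> \<kappa> S s \<inter> slab \<eta> \<kappa> (insert l S) s = {}"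
    using assms(1) unfolding slab_def by (auto split: if_splits) (smt (verit))
  ultimately show ?thesis
    using slab_lmeasurable[OF assms(2)] measure_Union[of lebesgue]
    by (metis fmeasurableD fmeasurableD2 infinity_ennreal_def)
qed

lemma integral_union_inter:
  fixes f :: "'a \<Rightarrow> 'b::euclidean_space"
  assumes "compact A" "compact B" "continuous_on UNIV f"
  shows "(LINT x:A \<union> B|lborel. f x) + (LINT x:A \<inter> B|lborel. f x) =
         (LINT x:A|lborel. f x) + (LINT x:B|lborel. f x)"
proof -
  have int: "integrable lborel (\<lambda>x. indicator K x *\<^sub>R f x)" if "compact K" for K
    using that assms(3) by (intro borel_integrable_compact) (auto intro: continuous_on_subset)
  have "(LINT x:A \<union> B|lborel. f x) + (LINT x:A \<inter> B|lborel. f x) =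
        (\<integral>x. indicator (A \<union> B) x *\<^sub>R f x + indicator (A \<inter> B) x *\<^sub>R f x \<partial>lborel)"
    unfolding set_lebesgue_integral_def using assms
    by (intro Bochner_Integration.integral_add[symmetric] int) auto
  also have "\<dots> = (\<integral>x. indicator A x *\<^sub>R f x + indicator B x *\<^sub>R f x \<partial>lborel)"
    by (intro Bochner_Integration.integral_cong) (auto simp: indicator_def)
  also have "\<dots> = (LINT x:A|lborel. f x) + (LINT x:B|lborel. f x)"
    unfolding set_lebesgue_integral_def using assms
    by (intro Bochner_Integration.integral_add int)
  finally show ?thesis .
qed

lemma measure_compact_eq_integral:
  assumes "compact A"
  shows "measure lebesgue A = (LINT x:A|lborel. (1::real))"
proof -
  have "A \<in> sets borel" using assms by (rule borel_compact)
  then show ?thesis using emeasure_compact_finite[OF assms]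
    by (simp add: set_lebesgue_integral_def)
qed

text \<open>
  If no point lies beyond both walls \<open>i\<close> and \<open>j\<close>, moving these walls outwards enlarges the polytope by
  two separate pieces.
\<close>

lemma Delta_two_bumps:
  assumes "s > 0" "i \<noteq> j" and disj: "slab \<eta> \<kappa> {i, j} s = {}"
  shows "Delta \<eta> (\<kappa> + axis i s) \<union> Delta \<eta> (\<kappa> + axis j s) = Delta \<eta> (\<kappa> + axis i s + axis j s)"
    and "Delta \<eta> (\<kappa> + axis i s) \<inter> Delta \<eta> (\<kappa> + axis j s) = Delta \<eta> \<kappa>"
proof -
  define R where "R x \<longleftrightarrow> (\<forall>k. k \<noteq> i \<longrightarrow> k \<noteq> j \<longrightarrow> \<eta> k \<bullet> x \<le> \<kappa> $ k)" for x
  have split: "x \<in> Delta \<eta> \<kappa>' \<longleftrightarrow> R x \<and> \<eta> i \<bullet> x \<le> \<kappa>' $ i \<and> \<eta> j \<bullet> x \<le> \<kappa>' $ j"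
    if "\<And>k. k \<noteq> i \<Longrightarrow> k \<noteq> j \<Longrightarrow> \<kappa>' $ k = \<kappa> $ k" for x \<kappa>'
    unfolding mem_Delta R_def using that by metis
  have mem: "x \<in> Delta \<eta> (\<kappa> + axis i s + axis j s) \<longleftrightarrow> R x \<and> \<eta> i \<bullet> x \<le> \<kappa> $ i + s \<and> \<eta> j \<bullet> x \<le> \<kappa> $ j + s"
    "x \<in> Delta \<eta> (\<kappa> + axis i s) \<longleftrightarrow> R x \<and> \<eta> i \<bullet> x \<le> \<kappa> $ i + s \<and> \<eta> j \<bullet> x \<le> \<kappa> $ j"
    "x \<in> Delta \<eta> (\<kappa> + axis j s) \<longleftrightarrow> R x \<and> \<eta> i \<bullet> x \<le> \<kappa> $ i \<and> \<eta> j \<bullet> x \<le> \<kappa> $ j + s"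
    "x \<in> Delta \<eta> \<kappa> \<longleftrightarrow> R x \<and> \<eta> i \<bullet> x \<le> \<kappa> $ i \<and> \<eta> j \<bullet> x \<le> \<kappa> $ j" for x
    using assms(2) by (subst split; simp add: axis_def)+
  have no: "\<not> (R x \<and> \<kappa> $ i < \<eta> i \<bullet> x \<and> \<eta> i \<bullet> x \<le> \<kappa> $ i + s \<and> \<kappa> $ j < \<eta> j \<bullet> x \<and> \<eta> j \<bullet> x \<le> \<kappa> $ j + s)" for x
  proof
    assume "R x \<and> \<kappa> $ i < \<eta> i \<bullet> x \<and> \<eta> i \<bullet> x \<le> \<kappa> $ i + s \<and> \<kappa> $ j < \<eta> j \<bullet> x \<and> \<eta> j \<bullet> x \<le> \<kappa> $ j + s"
    then have "x \<in> slab \<eta> \<kappa> {i, j} s" by (simp add: slab_def R_def)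
    with disj show False by blast
  qed
  show "Delta \<eta> (\<kappa> + axis i s) \<union> Delta \<eta> (\<kappa> + axis j s) = Delta \<eta> (\<kappa> + axis i s + axis j s)"
  proof (intro set_eqI)
    fix x
    show "x \<in> Delta \<eta> (\<kappa> + axis i s) \<union> Delta \<eta> (\<kappa> + axis j s) \<longleftrightarrow> x \<in> Delta \<eta> (\<kappa> + axis i s + axis j s)"
      unfolding Un_iff mem using no[of x] \<open>s > 0\<close> by linarith
  qed
  show "Delta \<eta> (\<kappa> + axis i s) \<inter> Delta \<eta> (\<kappa> + axis j s) = Delta \<eta> \<kappa>"
  proof (intro set_eqI)
    fix x
    show "x \<in> Delta \<eta> (\<kappa> + axis i s) \<inter> Delta \<eta> (\<kappa> + axis j s) \<longleftrightarrow> x \<in> Delta \<eta> \<kappa>"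
      unfolding Int_iff mem using \<open>s > 0\<close> by linarith
  qed
qed

lemma moment_exchange_Delta:
  assumes s: "s > 0" and ij: "i \<noteq> j" and disj: "slab \<eta> \<kappa> {i, j} s = {}"
    and mom: "moment_identity \<eta> h c \<gamma> \<kappa>" "moment_identity \<eta> h c \<gamma> (\<kappa> + axis i s)"
      "moment_identity \<eta> h c \<gamma> (\<kappa> + axis j s)" "moment_identity \<eta> h c \<gamma> (\<kappa> + axis i s + axis j s)"
  shows "\<gamma> i * measure lebesgue (slab \<eta> \<kappa> {j} s) + \<gamma> j * measure lebesgue (slab \<eta> \<kappa> {i} s) = 0"
proof -
  define V where "V \<kappa> = measure lebesgue (Delta \<eta> \<kappa>)" for \<kappa>
  define J where "J \<kappa> = (LINT x:Delta \<eta> \<kappa>|lborel. x)" for \<kappa>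
  define e where "e = (\<Sum>k\<in>UNIV. \<gamma> k * \<kappa> $ k) + c"
  have sum: "(\<Sum>k\<in>UNIV. \<gamma> k * (\<kappa> + axis l s) $ k) = (\<Sum>k\<in>UNIV. \<gamma> k * \<kappa> $ k) + \<gamma> l * s" for \<kappa> l
  proof -
    have "(\<Sum>k\<in>UNIV. \<gamma> k * (\<kappa> + axis l s) $ k) = (\<Sum>k\<in>UNIV. \<gamma> k * \<kappa> $ k + (if k = l then \<gamma> k * s else 0))"
      by (intro sum.cong) (auto simp: axis_def algebra_simps)
    then show ?thesis by (simp add: sum.distrib)
  qed
  note bumps = Delta_two_bumps[OF s ij disj]
  have V: "V (\<kappa> + axis i s + axis j s) + V \<kappa> = V (\<kappa> + axis i s) + V (\<kappa> + axis j s)"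
    using integral_union_inter[OF compact_Delta compact_Delta, of "\<lambda>x. 1::real" "\<kappa> + axis i s" "\<kappa> + axis j s"]
    unfolding bumps V_def measure_compact_eq_integral[OF compact_Delta] by simp
  have J: "J (\<kappa> + axis i s + axis j s) + J \<kappa> = J (\<kappa> + axis i s) + J (\<kappa> + axis j s)"
    using integral_union_inter[OF compact_Delta compact_Delta, of "\<lambda>x. x" "\<kappa> + axis i s" "\<kappa> + axis j s"]
    unfolding bumps J_def by simp
  have hJ: "h \<bullet> J (\<kappa> + axis i s + axis j s) + h \<bullet> J \<kappa> = h \<bullet> J (\<kappa> + axis i s) + h \<bullet> J (\<kappa> + axis j s)"
    using arg_cong[OF J, of "inner h"] by (simp add: inner_add_right)
  have m: "h \<bullet> J \<kappa> = e * V \<kappa>" "h \<bullet> J (\<kappa> + axis i s) = (e + \<gamma> i * s) * V (\<kappa> + axis i s)"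
    "h \<bullet> J (\<kappa> + axis j s) = (e + \<gamma> j * s) * V (\<kappa> + axis j s)"
    "h \<bullet> J (\<kappa> + axis i s + axis j s) = (e + \<gamma> i * s + \<gamma> j * s) * V (\<kappa> + axis i s + axis j s)"
    using mom unfolding moment_identity_def J_def[symmetric] V_def[symmetric] sum e_def
    by (simp_all add: algebra_simps)
  have Vij: "V (\<kappa> + axis i s + axis j s) = V (\<kappa> + axis i s) + V (\<kappa> + axis j s) - V \<kappa>" using V by simp
  have "s * (\<gamma> i * (V (\<kappa> + axis j s) - V \<kappa>) + \<gamma> j * (V (\<kappa> + axis i s) - V \<kappa>)) = 0"
    using hJ unfolding m Vij by (simp add: algebra_simps)
  moreover have "V (\<kappa> + axis l s) = V \<kappa> + measure lebesgue (slab \<eta> \<kappa> {l} s)" for l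
    using slab_insert[of l "{}" s \<kappa>] s by (simp add: V_def)
  ultimately show ?thesis using s by simp
qed

text \<open>
  The identity \<open>\<gamma> i * D\<^sub>j V + \<gamma> j * D\<^sub>i V = 0\<close> is preserved by taking differences in further directions.
  Each of these moves the support numbers once more by \<open>s\<close>, hence the margin in the last assumption.
\<close>

lemma moment_exchange:
  assumes s: "s > 0" and ij: "i \<noteq> j"
    and disj: "\<And>\<kappa>'. (\<And>k. \<bar>\<kappa>' $ k - \<kappa> $ k\<bar> \<le> \<epsilon> - s) \<Longrightarrow> slab \<eta> \<kappa>' {i, j} s = {}"
    and mom: "\<And>\<kappa>'. (\<And>k. \<bar>\<kappa>' $ k - \<kappa> $ k\<bar> \<le> \<epsilon>) \<Longrightarrow> moment_identity \<eta> h c \<gamma> \<kappa>'"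
    and S: "finite S" "i \<notin> S" "j \<notin> S" and near: "\<And>k. \<bar>\<kappa>' $ k - \<kappa> $ k\<bar> \<le> \<epsilon> - (real (card S) + 1) * s"
  shows "\<gamma> i * measure lebesgue (slab \<eta> \<kappa>' (insert j S) s) +
         \<gamma> j * measure lebesgue (slab \<eta> \<kappa>' (insert i S) s) = 0"
  using S near
proof (induction S arbitrary: \<kappa>' rule: finite_induct)
  case empty
  have near: "\<bar>\<kappa>' $ k - \<kappa> $ k\<bar> \<le> \<epsilon> - s" for k using empty.prems by simp
  have *: "\<bar>\<kappa>' $ k - \<kappa> $ k\<bar> \<le> \<epsilon>" "\<bar>(\<kappa>' + axis l s) $ k - \<kappa> $ k\<bar> \<le> \<epsilon>"
    "\<bar>(\<kappa>' + axis i s + axis j s) $ k - \<kappa> $ k\<bar> \<le> \<epsilon>" for k l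
    using near[of k] s ij by (auto simp: axis_def)
  show ?case
    by (rule moment_exchange_Delta[OF s ij disj[OF near] mom mom mom mom]) (rule *)+
next
  case (insert l S)
  have near: "\<bar>\<kappa>' $ k - \<kappa> $ k\<bar> \<le> \<epsilon> - (real (card S) + 1) * s - s" for k
    using insert.prems(3)[of k] insert.hyps by (simp add: algebra_simps)
  have 1: "\<bar>\<kappa>' $ k - \<kappa> $ k\<bar> \<le> \<epsilon> - (real (card S) + 1) * s"
    and 2: "\<bar>(\<kappa>' + axis l s) $ k - \<kappa> $ k\<bar> \<le> \<epsilon> - (real (card S) + 1) * s" for k
    using near[of k] s by (auto simp: axis_def)
  have diff: "measure lebesgue (slab \<eta> \<kappa>' (insert m (insert l S)) s) =
    measure lebesgue (slab \<eta> (\<kappa>' + axis l s) (insert m S) s) - measure lebesgue (slab \<eta> \<kappa>' (insert m S) s)"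
    if "m \<noteq> l" for m
    using slab_insert[of l "insert m S" s \<kappa>'] that insert.hyps s by (simp add: insert_commute)
  have "\<gamma> i * measure lebesgue (slab \<eta> \<kappa>' (insert j S) s) + \<gamma> j * measure lebesgue (slab \<eta> \<kappa>' (insert i S) s) = 0"
    "\<gamma> i * measure lebesgue (slab \<eta> (\<kappa>' + axis l s) (insert j S) s) +
     \<gamma> j * measure lebesgue (slab \<eta> (\<kappa>' + axis l s) (insert i S) s) = 0"
    using insert.prems by (auto intro!: insert.IH 1 2)
  moreover have "i \<noteq> l" "j \<noteq> l" using insert.prems by auto
  ultimately show ?case unfolding diff[OF \<open>i \<noteq> l\<close>] diff[OF \<open>j \<noteq> l\<close>] by (simp add: algebra_simps)
qed

end

lemma center_of_mass_translate:
  fixes A :: "'a::euclidean_space set"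
  assumes A: "compact A" and pos: "measure lborel A > 0"
  shows "center_of_mass ((+) w ` A) = w + center_of_mass A"
proof -
  have int: "integrable lborel (\<lambda>x. indicator A x *\<^sub>R f x)" if "continuous_on UNIV f"
    for f :: "'a \<Rightarrow> 'a"
    using that A by (intro borel_integrable_compact) (auto intro: continuous_on_subset)
  have Ab: "A \<in> sets borel" using A by (rule borel_compact)
  have wA: "compact ((+) w ` A)" using A by (rule compact_translation)
  have ind: "indicator ((+) w ` A) (w + x) = (indicator A x :: real)" for x by (auto simp: indicator_def)
  have "(LINT x:(+) w ` A|lborel. x) = (\<integral>x. indicator ((+) w ` A) x *\<^sub>R x \<partial>distr lborel borel ((+) w))"
    by (simp add: set_lebesgue_integral_def lborel_distr_plus)
  also have "\<dots> = (\<integral>x. indicator ((+) w ` A) (w + x) *\<^sub>R (w + x) \<partial>lborel)"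
    using borel_compact[OF wA] by (intro integral_distr) auto
  also have "\<dots> = (\<integral>x. indicator A x *\<^sub>R w + indicator A x *\<^sub>R x \<partial>lborel)"
    by (simp add: ind scaleR_add_right)
  also have "\<dots> = (\<integral>x. indicator A x *\<^sub>R w \<partial>lborel) + (\<integral>x. indicator A x *\<^sub>R x \<partial>lborel)"
    by (intro Bochner_Integration.integral_add int continuous_intros)
  also have "(\<integral>x. indicator A x *\<^sub>R w \<partial>lborel) = measure lborel A *\<^sub>R w"
    using Ab emeasure_compact_finite[OF A] by simp
  finally have J: "(LINT x:(+) w ` A|lborel. x) = measure lborel A *\<^sub>R w + (LINT x:A|lborel. x)"
    by (simp add: set_lebesgue_integral_def)
  have "measure lborel ((+) w ` A) = measure lborel A"
    using measure_translation[of w A] Ab borel_compact[OF wA] by simp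
  with J pos show ?thesis by (simp add: center_of_mass_def scaleR_add_right)
qed

section \<open>Edges of an asymmetric facet\<close>

text \<open>
  The edge of a simple polytope that leaves the vertex \<open>v\<close> along the facets \<open>T - {p}\<close> ends in a vertex
  \<open>u\<close>, where a facet \<open>q\<close> takes the place of \<open>p\<close>. Apart from \<open>p\<close> and \<open>q\<close>, the facets that meet the
  edge are those that contain it.
\<close>

lemma edge_end:
  fixes \<eta> :: "'n::finite \<Rightarrow> 'a::euclidean_space"
  assumes simple: "simple_polytope \<eta> \<kappa>" and v: "v extreme_point_of Delta \<eta> \<kappa>"
    and T: "T = active \<eta> \<kappa> v" and fr: "dual_frame \<eta> T d" and p: "p \<in> T"
  obtains \<tau> q u where "\<tau> > 0" "q \<notin> T" "u = v - \<tau> *\<^sub>R d p" "u extreme_point_of Delta \<eta> \<kappa>"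
    "active \<eta> \<kappa> u = insert q (T - {p})"
    "\<And>z. z \<in> Delta \<eta> \<kappa> \<Longrightarrow> T - {p} \<subseteq> active \<eta> \<kappa> z \<Longrightarrow> active \<eta> \<kappa> z \<subseteq> insert q T"
proof -
  have vD: "v \<in> Delta \<eta> \<kappa>" using v by (simp add: extreme_point_of_def)
  have dT: "\<eta> l \<bullet> d p = (if l = p then 1 else 0)" if "l \<in> T" for l
    using dual_frame_inner[OF fr p that] .
  \<comment> \<open>\<open>K\<close> holds the walls that the ray from \<open>v\<close> approaches, \<open>f k\<close> is the time when it hits wall \<open>k\<close>.\<close>
  define K where "K = {k. \<eta> k \<bullet> d p < 0}"
  define f where "f k = (\<kappa> $ k - \<eta> k \<bullet> v) / (- (\<eta> k \<bullet> d p))" for k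
  have KT: "k \<notin> T" if "k \<in> K" for k using that dT[of k] by (auto simp: K_def split: if_splits)
  have "K \<noteq> {}"
  proof
    assume "K = {}"
    then have "- d p = 0"
      by (intro recession_direction_zero[OF simple_polytope_bounded[OF simple]
            simple_polytope_nonempty[OF simple]]) (auto simp: K_def not_less)
    with dT[OF p] show False by simp
  qed
  then have "Min (f ` K) \<in> f ` K" by (intro Min_in) auto
  then obtain q where q: "q \<in> K" "f q = Min (f ` K)" by force
  have min: "f q \<le> f k" if "k \<in> K" for k using that q(2) by simp
  define u where "u = v - f q *\<^sub>R d p"
  have slack: "\<eta> k \<bullet> v < \<kappa> $ k" if "k \<notin> T" for k
    using that vD by (auto simp: T active_def mem_Delta less_le)
  have pos: "f q > 0"
    using slack[OF KT[OF q(1)]] q(1) by (auto simp: f_def K_def intro: divide_pos_neg)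
  have inner_u: "\<eta> k \<bullet> u = \<eta> k \<bullet> v - f q * (\<eta> k \<bullet> d p)" for k
    by (simp add: u_def inner_diff_right)
  have fq: "f k * (\<eta> k \<bullet> d p) = \<eta> k \<bullet> v - \<kappa> $ k" if "k \<in> K" for k
    using that by (auto simp: f_def K_def field_simps)
  have uD: "u \<in> Delta \<eta> \<kappa>" unfolding mem_Delta
  proof
    fix k
    show "\<eta> k \<bullet> u \<le> \<kappa> $ k"
    proof (cases "k \<in> K")
      case True
      have "f k * (\<eta> k \<bullet> d p) \<le> f q * (\<eta> k \<bullet> d p)"
        using min[OF True] True by (intro mult_right_mono_neg) (auto simp: K_def)
      then show ?thesis using fq[OF True] by (simp add: inner_u)
    next
      case False
      then have "0 \<le> f q * (\<eta> k \<bullet> d p)" using pos by (simp add: K_def not_less)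
      moreover have "\<eta> k \<bullet> v \<le> \<kappa> $ k" using vD by (simp add: mem_Delta)
      ultimately show ?thesis by (simp add: inner_u)
    qed
  qed
  have sub: "insert q (T - {p}) \<subseteq> active \<eta> \<kappa> u"
    using fq[OF q(1)] dT by (auto simp: active_def inner_u) (simp add: T active_def)
  have u: "u extreme_point_of Delta \<eta> \<kappa>"
  proof (rule extreme_point_if_separated[OF uD])
    fix y assume y: "\<And>l. l \<in> active \<eta> \<kappa> u \<Longrightarrow> \<eta> l \<bullet> y = 0"
    have yp: "y = (\<eta> p \<bullet> y) *\<^sub>R d p"
    proof (rule dual_frame_eqI[OF fr])
      fix l assume "l \<in> T"
      then show "\<eta> l \<bullet> y = \<eta> l \<bullet> ((\<eta> p \<bullet> y) *\<^sub>R d p)"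
        using y[of l] sub dT[of l] by (cases "l = p") auto
    qed
    then have "\<eta> q \<bullet> y = (\<eta> p \<bullet> y) * (\<eta> q \<bullet> d p)" by (metis inner_scaleR_right)
    moreover have "\<eta> q \<bullet> y = 0" using y sub by auto
    ultimately have "\<eta> p \<bullet> y = 0" using q(1) by (auto simp: K_def)
    with yp show "y = 0" by simp
  qed
  have "card (insert q (T - {p})) = card T"
    using p KT[OF q(1)] by (metis Diff_iff card_Suc_Diff1 card_insert_disjoint finite finite_Diff)
  then have act: "active \<eta> \<kappa> u = insert q (T - {p})"
    using card_active_eq_DIM[OF simple u] card_active_eq_DIM[OF simple v] sub T
    by (metis card_subset_eq finite)
  show thesis
  proof (rule that[OF pos KT[OF q(1)] u_def u act])
    fix z assume z: "z \<in> Delta \<eta> \<kappa>" "T - {p} \<subseteq> active \<eta> \<kappa> z"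
    define \<sigma> where "\<sigma> = \<kappa> $ p - \<eta> p \<bullet> z"
    have zv: "z = v - \<sigma> *\<^sub>R d p"
    proof (rule dual_frame_eqI[OF fr])
      fix l assume "l \<in> T"
      then show "\<eta> l \<bullet> z = \<eta> l \<bullet> (v - \<sigma> *\<^sub>R d p)"
        using z(2) dT[of l] by (cases "l = p") (auto simp: inner_diff_right \<sigma>_def T active_def)
    qed
    have \<sigma>: "0 \<le> \<sigma>" using z(1) by (simp add: \<sigma>_def mem_Delta)
    show "active \<eta> \<kappa> z \<subseteq> insert q T"
    proof
      fix k assume k: "k \<in> active \<eta> \<kappa> z"
      show "k \<in> insert q T"
      proof (rule ccontr)
        assume "k \<notin> insert q T"
        then have kT: "k \<notin> T" and kq: "k \<noteq> q" by auto
        have eqk: "\<eta> k \<bullet> v - \<sigma> * (\<eta> k \<bullet> d p) = \<kappa> $ k"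
          using k by (simp add: active_def zv inner_diff_right)
        with slack[OF kT] have "\<sigma> * (\<eta> k \<bullet> d p) < 0" by simp
        with \<sigma> have kK: "k \<in> K" by (auto simp: K_def mult_less_0_iff)
        have "\<sigma> = f k" using eqk kK by (auto simp: f_def K_def field_simps)
        then have "f q \<le> \<sigma>" using min[OF kK] by simp
        moreover have "\<sigma> \<le> f q"
        proof -
          have "\<eta> q \<bullet> v - \<sigma> * (\<eta> q \<bullet> d p) \<le> \<kappa> $ q"
            using z(1) by (auto simp: mem_Delta zv inner_diff_right)
          then have "f q * (\<eta> q \<bullet> d p) \<le> \<sigma> * (\<eta> q \<bullet> d p)" using fq[OF q(1)] by simp
          then show ?thesis using q(1) by (simp add: K_def mult_le_cancel_right)
        qed
        ultimately have "z = u" by (simp add: zv u_def)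
        with k act kT kq show False by auto
      qed
    qed
  qed
qed

lemma slab_measure_pos:
  fixes \<eta> :: "'n::finite \<Rightarrow> 'a::euclidean_space"
  assumes simple: "simple_polytope \<eta> \<kappa>" and v: "v extreme_point_of Delta \<eta> \<kappa>"
    and S: "S \<subseteq> active \<eta> \<kappa> v"
  obtains t where "t > 0" "\<And>s. 0 < s \<Longrightarrow> s \<le> t \<Longrightarrow> measure lebesgue (slab \<eta> \<kappa> S s) > 0"
proof -
  have bd: "bounded (Delta \<eta> \<kappa>')" for \<kappa>' by (rule simple_polytope_bounded_all[OF simple])
  let ?T = "active \<eta> \<kappa> v"
  have vD: "v \<in> Delta \<eta> \<kappa>" using v by (simp add: extreme_point_of_def)
  obtain d where fr: "dual_frame \<eta> ?T d" using simple_polytope_vertex_frame[OF simple v] .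
  define c :: "'n \<Rightarrow> real" where "c l = (if l \<in> S then 1/2 else -1)" for l
  define y where "y = (\<Sum>p\<in>?T. c p *\<^sub>R d p)"
  obtain t where t: "t > 0" "\<And>s k. \<bar>s\<bar> \<le> t \<Longrightarrow> k \<notin> ?T \<Longrightarrow> \<eta> k \<bullet> (v + s *\<^sub>R y) < \<kappa> $ k"
    "\<And>s l. l \<in> ?T \<Longrightarrow> \<eta> l \<bullet> (v + s *\<^sub>R y) = \<kappa> $ l + s * c l"
    using vertex_neighbour[OF fr refl vD, of c] unfolding y_def by blast
  show thesis
  proof (rule that[OF t(1)])
    fix s :: real assume s: "0 < s" "s \<le> t"
    define U where "U = (\<Inter>k. if k \<in> S then {x. \<kappa> $ k < \<eta> k \<bullet> x} \<inter> {x. \<eta> k \<bullet> x < \<kappa> $ k + s}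
                               else {x. \<eta> k \<bullet> x < \<kappa> $ k})"
    have "open U" unfolding U_def
      by (intro open_INT ballI) (auto intro!: open_Int open_halfspace_gt open_halfspace_lt)
    moreover have "v + s *\<^sub>R y \<in> U" unfolding U_def
    proof
      fix k
      show "v + s *\<^sub>R y \<in> (if k \<in> S then {x. \<kappa> $ k < \<eta> k \<bullet> x} \<inter> {x. \<eta> k \<bullet> x < \<kappa> $ k + s}
                               else {x. \<eta> k \<bullet> x < \<kappa> $ k})"
        using s t(2)[of s k] t(3)[of k s] S by (cases "k \<in> ?T") (auto simp: c_def)
    qed
    moreover have "U \<subseteq> slab \<eta> \<kappa> S s"
    proof
      fix x assume x: "x \<in> U"
      have "if k \<in> S then \<kappa> $ k < \<eta> k \<bullet> x \<and> \<eta> k \<bullet> x < \<kappa> $ k + s else \<eta> k \<bullet> x < \<kappa> $ k" for k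
        using INT_D[OF x[unfolded U_def] UNIV_I, of k] by (auto split: if_splits)
      then show "x \<in> slab \<eta> \<kappa> S s" unfolding slab_def mem_Collect_eq by (metis less_imp_le)
    qed
    ultimately show "measure lebesgue (slab \<eta> \<kappa> S s) > 0"
      using slab_lmeasurable[OF bd] s by (intro measure_pos_if_open_subset[of _ U]) auto
  qed
qed

text \<open>
  Let \<open>S\<close> be the facets along an edge with end facets \<open>p\<close> and \<open>q\<close>, and consider two thin slabs along it,
  with offsets \<open>s * a\<close> and \<open>s * b\<close>, that differ by the translation by \<open>s *\<^sub>R \<omega>\<close> as far as the walls in
  \<open>S\<close> are concerned. If \<open>\<omega>\<close> is parallel to the wall \<open>p\<close> and points away from the wall \<open>q\<close>, the translate
  of the first slab misses a piece of the second slab near \<open>q\<close>, so the second has larger volume.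
\<close>

lemma edge_slab_shift:
  fixes \<eta> :: "'n::finite \<Rightarrow> 'a::euclidean_space" and a b :: "'n \<Rightarrow> real"
  assumes simple: "simple_polytope \<eta> \<kappa>" and u: "u extreme_point_of Delta \<eta> \<kappa>"
    and act: "active \<eta> \<kappa> u = insert q S" and q: "q \<notin> S" and p: "p \<notin> insert q S"
    and \<epsilon>: "stable_radius \<eta> \<kappa> \<epsilon>"
    and edge: "\<And>z. z \<in> Delta \<eta> \<kappa> \<Longrightarrow> S \<subseteq> active \<eta> \<kappa> z \<Longrightarrow> active \<eta> \<kappa> z \<subseteq> insert q (insert p S)"
    and a: "\<And>k. 0 \<le> a k \<and> a k \<le> 1" "\<And>k. k \<notin> S \<Longrightarrow> a k = 0"
    and b: "\<And>k. 0 \<le> b k" "\<And>k. k \<notin> S \<Longrightarrow> b k = 0"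
    and \<omega>: "\<And>l. l \<in> S \<Longrightarrow> b l = a l + \<eta> l \<bullet> \<omega>" "\<eta> p \<bullet> \<omega> = 0" "\<eta> q \<bullet> \<omega> < 0"
  obtains t where "t > 0" "\<And>s. 0 < s \<Longrightarrow> s \<le> t \<Longrightarrow>
     measure lebesgue (slab \<eta> (\<chi> k. \<kappa> $ k + s * a k) S s) <
     measure lebesgue (slab \<eta> (\<chi> k. \<kappa> $ k + s * b k) S s)"
proof -
  have bd: "bounded (Delta \<eta> \<kappa>')" for \<kappa>' by (rule simple_polytope_bounded_all[OF simple])
  have uD: "u \<in> Delta \<eta> \<kappa>" using u by (simp add: extreme_point_of_def)
  obtain d where fr: "dual_frame \<eta> (active \<eta> \<kappa> u) d" using simple_polytope_vertex_frame[OF simple u] .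
  \<comment> \<open>The direction \<open>y\<close> from \<open>u\<close> leads into the middle of the region \<open>U\<close> below.\<close>
  define c where "c l = (if l = q then (\<eta> q \<bullet> \<omega>) / 2 else b l + 1/2)" for l
  define y where "y = (\<Sum>p\<in>active \<eta> \<kappa> u. c p *\<^sub>R d p)"
  obtain t where t: "t > 0" "\<And>s k. \<bar>s\<bar> \<le> t \<Longrightarrow> k \<notin> insert q S \<Longrightarrow> \<eta> k \<bullet> (u + s *\<^sub>R y) < \<kappa> $ k"
    "\<And>s l. l \<in> insert q S \<Longrightarrow> \<eta> l \<bullet> (u + s *\<^sub>R y) = \<kappa> $ l + s * c l"
    using vertex_neighbour[OF fr refl uD, of c] unfolding y_def act by blast
  define m where "m = 2 + (\<Sum>k\<in>UNIV. \<bar>\<eta> k \<bullet> \<omega>\<bar>)"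
  have m: "\<eta> k \<bullet> \<omega> \<le> m" for k
  proof -
    have "\<bar>\<eta> k \<bullet> \<omega>\<bar> \<le> (\<Sum>k\<in>UNIV. \<bar>\<eta> k \<bullet> \<omega>\<bar>)" by (intro member_le_sum) auto
    then show ?thesis by (simp add: m_def)
  qed
  have m2: "m \<ge> 2" by (simp add: m_def sum_nonneg)
  have \<epsilon>pos: "\<epsilon> > 0" using \<epsilon> by (simp add: stable_radius_def)
  define t' where "t' = min t (\<epsilon> / m)"
  have t': "t' > 0" using t(1) \<epsilon>pos m2 by (simp add: t'_def)
  show thesis
  proof (rule that[OF t'])
    fix s :: real assume s: "0 < s" "s \<le> t'"
    have st: "\<bar>s\<bar> \<le> t" using s by (simp add: t'_def)
    have sm: "s * m \<le> \<epsilon>" using s m2 by (simp add: t'_def field_simps)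
    have s\<omega>: "s * (\<eta> k \<bullet> \<omega>) \<le> \<epsilon>" for k
      using mult_left_mono[OF m[of k], of s] s(1) sm by linarith
    have s2: "2 * s \<le> \<epsilon>" using mult_left_mono[OF m2, of s] s(1) sm by linarith
    let ?A = "slab \<eta> (\<chi> k. \<kappa> $ k + s * a k) S s" and ?B = "slab \<eta> (\<chi> k. \<kappa> $ k + s * b k) S s"
    have memA: "x \<in> ?A \<longleftrightarrow> (\<forall>k. if k \<in> S then \<kappa> $ k + s * a k < \<eta> k \<bullet> x \<and> \<eta> k \<bullet> x \<le> \<kappa> $ k + s * a k + s
          else \<eta> k \<bullet> x \<le> \<kappa> $ k)" for x
      using a(2) unfolding slab_def by (simp cong: if_cong)
    have memB: "x \<in> ?B \<longleftrightarrow> (\<forall>k. if k \<in> S then \<kappa> $ k + s * b k < \<eta> k \<bullet> x \<and> \<eta> k \<bullet> x \<le> \<kappa> $ k + s * b k + s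
          else \<eta> k \<bullet> x \<le> \<kappa> $ k)" for x
      using b(2) unfolding slab_def by (simp cong: if_cong)
    have far: "\<eta> k \<bullet> x < \<kappa> $ k - \<epsilon>" if x: "x \<in> ?A" and k: "k \<notin> insert q (insert p S)" for x k
    proof (rule ccontr)
      assume "\<not> ?thesis"
      then have kx: "\<kappa> $ k - \<epsilon> \<le> \<eta> k \<bullet> x" by simp
      have up: "\<eta> l \<bullet> x \<le> \<kappa> $ l + \<epsilon>" for l
      proof -
        have "s * a l \<le> s" using a(1)[of l] s by (simp add: mult_left_le)
        moreover have "\<eta> l \<bullet> x \<le> \<kappa> $ l + s * a l + s \<or> \<eta> l \<bullet> x \<le> \<kappa> $ l"
          using x[unfolded memA, rule_format, of l] by (auto split: if_splits)
        ultimately show ?thesis using s(1) s2 by linarith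
      qed
      have lo: "\<kappa> $ l - \<epsilon> \<le> \<eta> l \<bullet> x" if "l \<in> insert k S" for l
      proof (cases "l = k")
        case False
        then have "\<kappa> $ l + s * a l < \<eta> l \<bullet> x" using that x[unfolded memA, rule_format, of l] by auto
        moreover have "0 \<le> s * a l" using a(1)[of l] s by simp
        ultimately show ?thesis using \<epsilon>pos by simp
      qed (use kx in simp)
      obtain z where z: "z \<in> Delta \<eta> \<kappa>" "insert k S \<subseteq> active \<eta> \<kappa> z"
        using stable_radiusD[OF \<epsilon> up lo] by blast
      then show False using edge[of z] k by blast
    qed
    \<comment> \<open>On the first slab all inequalities other than \<open>p\<close>, \<open>q\<close> and those in \<open>S\<close> have slack more than
      \<open>\<epsilon>\<close>, which the translation does not use up.\<close>
    have sub: "(+) (s *\<^sub>R \<omega>) ` ?A \<subseteq> ?B"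
    proof
      fix x assume "x \<in> (+) (s *\<^sub>R \<omega>) ` ?A"
      then obtain x0 where x0: "x0 \<in> ?A" "x = s *\<^sub>R \<omega> + x0" by blast
      have ex: "\<eta> k \<bullet> x = s * (\<eta> k \<bullet> \<omega>) + \<eta> k \<bullet> x0" for k by (simp add: x0(2) inner_add_right)
      show "x \<in> ?B" unfolding memB
      proof
        fix k
        have A: "if k \<in> S then \<kappa> $ k + s * a k < \<eta> k \<bullet> x0 \<and> \<eta> k \<bullet> x0 \<le> \<kappa> $ k + s * a k + s
          else \<eta> k \<bullet> x0 \<le> \<kappa> $ k" using x0(1)[unfolded memA] by blast
        show "if k \<in> S then \<kappa> $ k + s * b k < \<eta> k \<bullet> x \<and> \<eta> k \<bullet> x \<le> \<kappa> $ k + s * b k + s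
          else \<eta> k \<bullet> x \<le> \<kappa> $ k"
        proof (cases "k \<in> S")
          case True
          then have "s * b k = s * a k + s * (\<eta> k \<bullet> \<omega>)" using \<omega>(1)[OF True] by (simp add: distrib_left)
          then show ?thesis using A True by (simp add: ex)
        next
          case False
          have "s * (\<eta> k \<bullet> \<omega>) + \<eta> k \<bullet> x0 \<le> \<kappa> $ k"
          proof (cases "k \<in> {p, q}")
            case True
            then have "s * (\<eta> k \<bullet> \<omega>) \<le> 0" using \<omega>(2,3) s by (auto simp: mult_le_0_iff)
            then show ?thesis using A False by simp
          next
            case 2: False
            then show ?thesis using far[OF x0(1), of k] s\<omega>[of k] False by simp
          qed
          then show ?thesis using False by (simp add: ex)
        qed
      qed
    qed
    \<comment> \<open>Points of the second slab so close to the wall \<open>q\<close> that the translate does not reach them.\<close>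
    define U where "U = (\<Inter>k. if k \<in> S then {x. \<kappa> $ k + s * b k < \<eta> k \<bullet> x} \<inter> {x. \<eta> k \<bullet> x < \<kappa> $ k + s * b k + s}
       else if k = q then {x. \<kappa> $ k + s * (\<eta> k \<bullet> \<omega>) < \<eta> k \<bullet> x} \<inter> {x. \<eta> k \<bullet> x < \<kappa> $ k}
       else {x. \<eta> k \<bullet> x < \<kappa> $ k})"
    have op: "open U" unfolding U_def
      by (intro open_INT ballI) (auto intro!: open_Int open_halfspace_gt open_halfspace_lt)
    have "u + s *\<^sub>R y \<in> U" unfolding U_def
    proof
      fix k
      show "u + s *\<^sub>R y \<in> (if k \<in> S then {x. \<kappa> $ k + s * b k < \<eta> k \<bullet> x} \<inter> {x. \<eta> k \<bullet> x < \<kappa> $ k + s * b k + s}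
         else if k = q then {x. \<kappa> $ k + s * (\<eta> k \<bullet> \<omega>) < \<eta> k \<bullet> x} \<inter> {x. \<eta> k \<bullet> x < \<kappa> $ k}
         else {x. \<eta> k \<bullet> x < \<kappa> $ k})"
        using s t(2)[OF st, of k] t(3)[of k s] q \<omega>(3)
        by (cases "k \<in> insert q S") (auto simp: c_def distrib_left mult_pos_neg)
    qed
    then have ne: "U \<noteq> {}" by blast
    have Umem: "if k \<in> S then \<kappa> $ k + s * b k < \<eta> k \<bullet> x \<and> \<eta> k \<bullet> x < \<kappa> $ k + s * b k + s
        else if k = q then \<kappa> $ k + s * (\<eta> k \<bullet> \<omega>) < \<eta> k \<bullet> x \<and> \<eta> k \<bullet> x < \<kappa> $ k
        else \<eta> k \<bullet> x < \<kappa> $ k" if "x \<in> U" for x k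
      using INT_D[OF that[unfolded U_def] UNIV_I, of k] by (auto split: if_splits)
    have "U \<subseteq> ?B - (+) (s *\<^sub>R \<omega>) ` ?A"
    proof
      fix x assume x: "x \<in> U"
      have "x \<in> ?B" unfolding memB
      proof
        fix k show "if k \<in> S then \<kappa> $ k + s * b k < \<eta> k \<bullet> x \<and> \<eta> k \<bullet> x \<le> \<kappa> $ k + s * b k + s
            else \<eta> k \<bullet> x \<le> \<kappa> $ k"
          using Umem[OF x, of k] by (auto split: if_splits)
      qed
      moreover have "x \<notin> (+) (s *\<^sub>R \<omega>) ` ?A"
      proof
        assume "x \<in> (+) (s *\<^sub>R \<omega>) ` ?A"
        then obtain x0 where x0: "x0 \<in> ?A" "x = s *\<^sub>R \<omega> + x0" by blast
        have "\<eta> q \<bullet> x0 \<le> \<kappa> $ q" using x0(1)[unfolded memA, rule_format, of q] q by simp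
        moreover have "\<kappa> $ q + s * (\<eta> q \<bullet> \<omega>) < \<eta> q \<bullet> x" using Umem[OF x, of q] q by simp
        ultimately show False by (simp add: x0(2) inner_add_right)
      qed
      ultimately show "x \<in> ?B - (+) (s *\<^sub>R \<omega>) ` ?A" by blast
    qed
    then show "measure lebesgue ?A < measure lebesgue ?B"
      using slab_lmeasurable[OF bd] s sub op ne by (intro measure_translate_strict_subset[of _ _ "s *\<^sub>R \<omega>" U]) auto
  qed
qed

text \<open>
  If slabs along an edge of the facet \<open>i\<close> keep their volume when pushed across that facet, the direction
  \<open>\<xi>\<close> of the edge leaving the facet at one end is also tangent to the facet \<open>q\<close> at the other end \<open>u\<close>.
  Otherwise one of the two slabs, translated by \<open>s *\<^sub>R \<xi>\<close> or its negative, fits strictly into the other.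
\<close>

lemma flat_edge:
  fixes \<eta> :: "'n::finite \<Rightarrow> 'a::euclidean_space"
  assumes simple: "simple_polytope \<eta> \<kappa>" and \<epsilon>: "stable_radius \<eta> \<kappa> \<epsilon>"
    and u: "u extreme_point_of Delta \<eta> \<kappa>" and act: "active \<eta> \<kappa> u = insert q S"
    and q: "q \<notin> S" and p: "p \<notin> insert q S" and i: "i \<in> S"
    and edge: "\<And>z. z \<in> Delta \<eta> \<kappa> \<Longrightarrow> S \<subseteq> active \<eta> \<kappa> z \<Longrightarrow> active \<eta> \<kappa> z \<subseteq> insert q (insert p S)"
    and eq: "s\<^sub>0 > 0" "\<And>s. 0 < s \<Longrightarrow> s \<le> s\<^sub>0 \<Longrightarrow>
        measure lebesgue (slab \<eta> (\<kappa> + axis i s) S s) = measure lebesgue (slab \<eta> \<kappa> S s)"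
    and \<xi>: "\<eta> i \<bullet> \<xi> = 1" "\<And>l. l \<in> insert p S \<Longrightarrow> l \<noteq> i \<Longrightarrow> \<eta> l \<bullet> \<xi> = 0"
  shows "\<eta> q \<bullet> \<xi> = 0"
proof -
  define e where "e k = (if k = i then 1 else 0 :: real)" for k
  have bump: "(\<chi> k. \<kappa> $ k + s * e k) = \<kappa> + axis i s" for s
    by (simp add: vec_eq_iff axis_def e_def)
  have zero: "(\<chi> k. \<kappa> $ k + s * 0) = \<kappa>" for s by (simp add: vec_eq_iff)
  have p\<xi>: "\<eta> p \<bullet> \<xi> = 0" using \<xi>(2)[of p] i p by auto
  have S\<xi>: "e l = \<eta> l \<bullet> \<xi>" if "l \<in> S" for l using that \<xi> by (auto simp: e_def)
  have eS: "e l = 0" if "l \<notin> S" for l using that i by (auto simp: e_def)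
  have e01: "0 \<le> e k \<and> e k \<le> 1" for k by (simp add: e_def)
  show ?thesis
  proof (rule linorder_cases[of "\<eta> q \<bullet> \<xi>" 0])
    assume neg: "\<eta> q \<bullet> \<xi> < 0"
    obtain t where t: "t > 0" "\<And>s. 0 < s \<Longrightarrow> s \<le> t \<Longrightarrow>
       measure lebesgue (slab \<eta> (\<chi> k. \<kappa> $ k + s * 0) S s) <
       measure lebesgue (slab \<eta> (\<chi> k. \<kappa> $ k + s * e k) S s)"
      by (rule edge_slab_shift[OF simple u act q p \<epsilon> edge, of "\<lambda>_. 0" e \<xi>])
        (use e01 eS S\<xi> p\<xi> neg in auto)
    from t(2)[of "min t s\<^sub>0"] eq(2)[of "min t s\<^sub>0"] t(1) eq(1) show ?thesis
      unfolding bump zero by simp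
  next
    assume pos: "0 < \<eta> q \<bullet> \<xi>"
    obtain t where t: "t > 0" "\<And>s. 0 < s \<Longrightarrow> s \<le> t \<Longrightarrow>
       measure lebesgue (slab \<eta> (\<chi> k. \<kappa> $ k + s * e k) S s) <
       measure lebesgue (slab \<eta> (\<chi> k. \<kappa> $ k + s * 0) S s)"
      by (rule edge_slab_shift[OF simple u act q p \<epsilon> edge, of e "\<lambda>_. 0" "-\<xi>"])
        (use e01 eS S\<xi> p\<xi> pos in auto)
    from t(2)[of "min t s\<^sub>0"] eq(2)[of "min t s\<^sub>0"] t(1) eq(1) show ?thesis
      unfolding bump zero by simp
  qed
qed

lemma finite_extreme_points:
  fixes \<eta> :: "'n::finite \<Rightarrow> 'a::euclidean_space"
  assumes simple: "simple_polytope \<eta> \<kappa>"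
  shows "finite {v. v extreme_point_of Delta \<eta> \<kappa>}"
proof (rule finite_imageD)
  show "finite (active \<eta> \<kappa> ` {v. v extreme_point_of Delta \<eta> \<kappa>})" by (rule finite)
  show "inj_on (active \<eta> \<kappa>) {v. v extreme_point_of Delta \<eta> \<kappa>}"
  proof (rule inj_onI)
    fix v w assume vw: "v \<in> {v. v extreme_point_of Delta \<eta> \<kappa>}" "active \<eta> \<kappa> v = active \<eta> \<kappa> w"
    obtain d where fr: "dual_frame \<eta> (active \<eta> \<kappa> v) d"
      using simple_polytope_vertex_frame[OF simple] vw(1) by blast
    show "v = w"
    proof (rule dual_frame_eqI[OF fr])
      fix l assume "l \<in> active \<eta> \<kappa> v"
      then have "l \<in> active \<eta> \<kappa> v" "l \<in> active \<eta> \<kappa> w" using vw(2) by auto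
      then show "\<eta> l \<bullet> v = \<eta> l \<bullet> w" by (simp add: active_def)
    qed
  qed
qed

text \<open>
  The hypothesis \<open>eq\<close> states that pushing a slab along a face of the facet \<open>i\<close> across this facet keeps
  its volume. The conclusion is that all facets meeting the facet \<open>i\<close> are parallel to one direction \<open>\<xi>\<close>
  transversal to it.
\<close>

lemma flat_facet:
  fixes \<eta> :: "'n::finite \<Rightarrow> 'a::euclidean_space"
  assumes simple: "simple_polytope \<eta> \<kappa>" and \<epsilon>: "stable_radius \<eta> \<kappa> \<epsilon>"
    and eq: "s\<^sub>0 > 0" "\<And>S s v. v \<in> Delta \<eta> \<kappa> \<Longrightarrow> S \<subseteq> active \<eta> \<kappa> v \<Longrightarrow> i \<in> S \<Longrightarrow> 0 < s \<Longrightarrow> s \<le> s\<^sub>0 \<Longrightarrow>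
        measure lebesgue (slab \<eta> (\<kappa> + axis i s) S s) = measure lebesgue (slab \<eta> \<kappa> S s)"
  obtains \<xi> where "\<eta> i \<bullet> \<xi> = 1" "\<And>k. k \<noteq> i \<Longrightarrow> facet \<eta> \<kappa> i \<inter> facet \<eta> \<kappa> k \<noteq> {} \<Longrightarrow> \<eta> k \<bullet> \<xi> = 0"
proof -
  obtain v where v: "v extreme_point_of Delta \<eta> \<kappa>" "i \<in> active \<eta> \<kappa> v"
    using simple_facet_vertex[OF simple] by blast
  obtain d\<^sub>0 where fr0: "dual_frame \<eta> (active \<eta> \<kappa> v) d\<^sub>0" using simple_polytope_vertex_frame[OF simple v(1)] .
  define \<xi> where "\<xi> = d\<^sub>0 i"
  have \<xi>i: "\<eta> i \<bullet> \<xi> = 1" using dual_frame_inner[OF fr0 v(2) v(2)] by (simp add: \<xi>_def)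
  \<comment> \<open>The vertices of the facet \<open>i\<close> from which the edge leaving that facet has direction \<open>\<xi>\<close>.\<close>
  define Y where "Y = {u. u extreme_point_of Delta \<eta> \<kappa> \<and> i \<in> active \<eta> \<kappa> u \<and>
                           (\<forall>l\<in>active \<eta> \<kappa> u. l \<noteq> i \<longrightarrow> \<eta> l \<bullet> \<xi> = 0)}"
  have "v \<in> Y" using v dual_frame_inner[OF fr0 v(2)] by (auto simp: Y_def \<xi>_def)
  have finY: "finite Y"
    by (rule finite_subset[OF _ finite_extreme_points[OF simple]]) (auto simp: Y_def)
  show thesis
  proof (rule that[OF \<xi>i])
    fix k assume k: "k \<noteq> i" "facet \<eta> \<kappa> i \<inter> facet \<eta> \<kappa> k \<noteq> {}"
    then obtain z where z: "z \<in> Delta \<eta> \<kappa>" "\<eta> i \<bullet> z = \<kappa> $ i" "\<eta> k \<bullet> z = \<kappa> $ k"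
      by (auto simp: mem_facet)
    \<comment> \<open>A vertex of \<open>Y\<close> at which \<open>\<eta> k\<close> is largest: if it missed the facet \<open>k\<close>, an improving edge of the
      facet \<open>i\<close> would lead to another vertex of \<open>Y\<close>.\<close>
    have "Max ((\<lambda>u. \<eta> k \<bullet> u) ` Y) \<in> (\<lambda>u. \<eta> k \<bullet> u) ` Y"
      using finY \<open>v \<in> Y\<close> by (intro Max_in) auto
    then obtain u where u: "u \<in> Y" "Max ((\<lambda>u. \<eta> k \<bullet> u) ` Y) = \<eta> k \<bullet> u" by blast
    have max: "\<eta> k \<bullet> u' \<le> \<eta> k \<bullet> u" if "u' \<in> Y" for u'
      using finY that u(2) by (metis Max_ge finite_imageI imageI)
    let ?T = "active \<eta> \<kappa> u"
    have uE: "u extreme_point_of Delta \<eta> \<kappa>" and iu: "i \<in> ?T"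
      and \<xi>u: "\<And>l. l \<in> ?T \<Longrightarrow> l \<noteq> i \<Longrightarrow> \<eta> l \<bullet> \<xi> = 0" using u(1) by (auto simp: Y_def)
    have uD: "u \<in> Delta \<eta> \<kappa>" using uE by (simp add: extreme_point_of_def)
    obtain d where fr: "dual_frame \<eta> ?T d" using simple_polytope_vertex_frame[OF simple uE] .
    show "\<eta> k \<bullet> \<xi> = 0"
    proof (cases "k \<in> ?T")
      case True then show ?thesis using \<xi>u k(1) by blast
    next
      case False
      then have "\<eta> k \<bullet> u < \<kappa> $ k" using uD by (auto simp: active_def mem_Delta less_le)
      then have "0 < \<eta> k \<bullet> (z - u)" using z by (simp add: inner_diff_right)
      also have "\<eta> k \<bullet> (z - u) = (\<Sum>p\<in>?T. (\<eta> p \<bullet> (z - u)) * (\<eta> k \<bullet> d p))"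
        by (subst dual_frame_expand[OF fr, of "z - u"]) (simp add: inner_sum_right)
      finally obtain p where p: "p \<in> ?T" "0 < (\<eta> p \<bullet> (z - u)) * (\<eta> k \<bullet> d p)"
        by (meson not_less sum_nonpos)
      have "\<eta> p \<bullet> (z - u) \<le> 0" using z(1) p(1) by (auto simp: active_def mem_Delta inner_diff_right)
      with p(2) have kd: "\<eta> k \<bullet> d p < 0" by (auto simp: zero_less_mult_iff)
      have pi: "p \<noteq> i" using p(2) iu z(2) by (auto simp: active_def inner_diff_right)
      obtain \<tau> q u' where e: "\<tau> > 0" "q \<notin> ?T" "u' = u - \<tau> *\<^sub>R d p" "u' extreme_point_of Delta \<eta> \<kappa>"
        "active \<eta> \<kappa> u' = insert q (?T - {p})"
        "\<And>z. z \<in> Delta \<eta> \<kappa> \<Longrightarrow> ?T - {p} \<subseteq> active \<eta> \<kappa> z \<Longrightarrow> active \<eta> \<kappa> z \<subseteq> insert q ?T"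
        using edge_end[OF simple uE refl fr p(1)] by metis
      have ins: "insert q (insert p (?T - {p})) = insert q ?T" using p(1) by blast
      have "\<eta> q \<bullet> \<xi> = 0"
      proof (rule flat_edge[OF simple \<epsilon> e(4,5) _ _ _ _ eq(1)])
        show "i \<in> ?T - {p}" using iu pi by blast
        show "q \<notin> ?T - {p}" "p \<notin> insert q (?T - {p})" using e(2) p(1) by auto
        show "active \<eta> \<kappa> z \<subseteq> insert q (insert p (?T - {p}))"
          if "z \<in> Delta \<eta> \<kappa>" "?T - {p} \<subseteq> active \<eta> \<kappa> z" for z
          using e(6)[OF that] unfolding ins .
        show "measure lebesgue (slab \<eta> (\<kappa> + axis i s) (?T - {p}) s) = measure lebesgue (slab \<eta> \<kappa> (?T - {p}) s)"
          if "0 < s" "s \<le> s\<^sub>0" for s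
          by (rule eq(2)[OF uD _ _ that]) (use iu pi in auto)
      qed (use \<xi>i \<xi>u p(1) in auto)
      then have "u' \<in> Y" using e(4,5) iu pi \<xi>u by (auto simp: Y_def)
      from max[OF this] have "0 \<le> \<tau> * (\<eta> k \<bullet> d p)" by (simp add: e(3) inner_diff_right)
      with e(1) kd show ?thesis by (simp add: zero_le_mult_iff)
    qed
  qed
qed

lemma stable_slab_empty:
  fixes \<eta> :: "'n::finite \<Rightarrow> 'a::euclidean_space"
  assumes \<epsilon>: "stable_radius \<eta> \<kappa> \<epsilon>" and disj: "facet \<eta> \<kappa> i \<inter> facet \<eta> \<kappa> j = {}"
    and s: "s > 0" and S: "i \<in> S" "j \<in> S" and near: "\<And>k. \<bar>\<kappa>' $ k - \<kappa> $ k\<bar> \<le> \<epsilon> - s"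
  shows "slab \<eta> \<kappa>' S s = {}"
proof (rule ccontr)
  assume "slab \<eta> \<kappa>' S s \<noteq> {}"
  then obtain x where x: "\<And>k. if k \<in> S then \<kappa>' $ k < \<eta> k \<bullet> x \<and> \<eta> k \<bullet> x \<le> \<kappa>' $ k + s
                              else \<eta> k \<bullet> x \<le> \<kappa>' $ k" by (auto simp: slab_def)
  have up: "\<eta> k \<bullet> x \<le> \<kappa> $ k + \<epsilon>" for k using x[of k] near[of k] s by (auto split: if_splits)
  have lo: "\<kappa> $ k - \<epsilon> \<le> \<eta> k \<bullet> x" if "k \<in> {i, j}" for k
  proof -
    have "\<kappa>' $ k < \<eta> k \<bullet> x" using x[of k] S that by auto
    then show ?thesis using near[of k] s by linarith
  qed
  obtain z where "z \<in> Delta \<eta> \<kappa>" "{i, j} \<subseteq> active \<eta> \<kappa> z" using stable_radiusD[OF \<epsilon> up lo] by blast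
  then have "z \<in> facet \<eta> \<kappa> i \<inter> facet \<eta> \<kappa> j" by (auto simp: mem_facet active_def)
  with disj show False by blast
qed

lemma mass_linear_moment_identity:
  fixes \<eta> :: "'n::finite \<Rightarrow> 'a::euclidean_space"
  assumes bd: "\<And>\<kappa>. bounded (Delta \<eta> \<kappa>)" and simple: "simple_polytope \<eta> \<kappa>"
    and lin: "h \<bullet> center_of_mass (Delta \<eta> \<kappa>) = (\<Sum>k\<in>UNIV. \<gamma> k * \<kappa> $ k) + c"
  shows "measure lebesgue (Delta \<eta> \<kappa>) > 0" "moment_identity \<eta> h c \<gamma> \<kappa>"
proof -
  show pos: "measure lebesgue (Delta \<eta> \<kappa>) > 0"
    using slab_measure_pos[OF simple, of _ "{}"] simple_facet_vertex[OF simple]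
    by (metis empty_subsetI order_refl slab_empty)
  have "Delta \<eta> \<kappa> \<in> sets borel" by (simp add: closed_Delta borel_closed)
  then have "measure lborel (Delta \<eta> \<kappa>) = measure lebesgue (Delta \<eta> \<kappa>)" by simp
  with pos lin show "moment_identity \<eta> h c \<gamma> \<kappa>"
    unfolding moment_identity_def center_of_mass_def by (simp add: field_simps)
qed

section \<open>Mass linear functions and asymmetric facets\<close>

text \<open>
  Mass linearity is only used in a box around \<open>\<kappa>\<close>. The formula for \<open>h\<close> compares the polytope with its
  small translates, whose support numbers lie in that box.
\<close>

lemma mass_linear_data:
  fixes \<eta> :: "'n::finite \<Rightarrow> 'a::euclidean_space"
  assumes simple: "simple_polytope \<eta> \<kappa>" and ml: "mass_linear \<eta> \<kappa> H"
  obtains h \<gamma> c \<epsilon> where "affine_with_linear_part H (\<lambda>x. h \<bullet> x)" "h = (\<Sum>k\<in>UNIV. \<gamma> k *\<^sub>R \<eta> k)"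
    "stable_radius \<eta> \<kappa> \<epsilon>" "\<And>\<kappa>'. (\<And>k. \<bar>\<kappa>' $ k - \<kappa> $ k\<bar> \<le> \<epsilon>) \<Longrightarrow> moment_identity \<eta> h c \<gamma> \<kappa>'"
proof -
  have bd: "bounded (Delta \<eta> \<kappa>')" for \<kappa>' by (rule simple_polytope_bounded_all[OF simple])
  obtain L c\<^sub>0 \<gamma> C where L: "linear L" "\<And>x. H x = L x + c\<^sub>0"
    and \<gamma>: "\<And>\<kappa>'. \<kappa>' \<in> chamber \<eta> \<kappa> \<Longrightarrow> H (center_of_mass (Delta \<eta> \<kappa>')) = (\<Sum>i\<in>UNIV. \<gamma> i * \<kappa>' $ i) + C"
    using ml unfolding mass_linear_def affine_with_linear_part_def by metis
  define h where "h = adjoint L 1"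
  have h: "L x = h \<bullet> x" for x
    using adjoint_works[OF L(1), of x 1] by (simp add: h_def inner_commute)
  have aff: "affine_with_linear_part H (\<lambda>x. h \<bullet> x)"
  proof -
    have "L = (\<lambda>x. h \<bullet> x)" using h by auto
    then show ?thesis unfolding affine_with_linear_part_def using L by blast
  qed
  obtain \<epsilon>\<^sub>1 where \<epsilon>1: "stable_radius \<eta> \<kappa> \<epsilon>\<^sub>1"
    using stable_radius_exists[OF simple_polytope_bounded[OF simple] simple_polytope_nonempty[OF simple]] .
  obtain \<epsilon>\<^sub>2 where \<epsilon>2: "\<epsilon>\<^sub>2 > 0" "\<And>\<kappa>'. (\<And>k. \<bar>\<kappa>' $ k - \<kappa> $ k\<bar> \<le> \<epsilon>\<^sub>2) \<Longrightarrow> \<kappa>' \<in> chamber \<eta> \<kappa>"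
    using chamber_contains_box[OF simple] by blast
  define \<epsilon> where "\<epsilon> = min \<epsilon>\<^sub>1 \<epsilon>\<^sub>2"
  have \<epsilon>pos: "\<epsilon> > 0" using \<epsilon>1 \<epsilon>2 by (simp add: \<epsilon>_def stable_radius_def)
  have \<epsilon>: "stable_radius \<eta> \<kappa> \<epsilon>" using \<epsilon>1 \<epsilon>pos by (rule stable_radius_mono) (simp add: \<epsilon>_def)
  have box: "\<kappa>' \<in> chamber \<eta> \<kappa>" if "\<And>k. \<bar>\<kappa>' $ k - \<kappa> $ k\<bar> \<le> \<epsilon>" for \<kappa>'
  proof (rule \<epsilon>2(2))
    fix k show "\<bar>\<kappa>' $ k - \<kappa> $ k\<bar> \<le> \<epsilon>\<^sub>2" using that[of k] by (simp add: \<epsilon>_def)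
  qed
  have lin: "h \<bullet> center_of_mass (Delta \<eta> \<kappa>') = (\<Sum>k\<in>UNIV. \<gamma> k * \<kappa>' $ k) + (C - c\<^sub>0)"
    if "\<kappa>' \<in> chamber \<eta> \<kappa>" for \<kappa>' using \<gamma>[OF that] by (simp add: L(2) h)
  define c where "c = C - c\<^sub>0"
  have mom: "moment_identity \<eta> h c \<gamma> \<kappa>'" if "\<And>k. \<bar>\<kappa>' $ k - \<kappa> $ k\<bar> \<le> \<epsilon>" for \<kappa>'
    using mass_linear_moment_identity(2)[OF bd simple_polytope_chamber lin] box[OF that] unfolding c_def by blast
  have \<kappa>ch: "\<kappa> \<in> chamber \<eta> \<kappa>" by (rule box) (use \<epsilon>pos in simp)
  have small: "h \<bullet> w = (\<Sum>k\<in>UNIV. \<gamma> k *\<^sub>R \<eta> k) \<bullet> w" if w: "\<And>k. \<bar>\<eta> k \<bullet> w\<bar> \<le> \<epsilon>" for w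
  proof -
    let ?\<kappa> = "\<chi> k. \<kappa> $ k + \<eta> k \<bullet> w"
    have ch: "?\<kappa> \<in> chamber \<eta> \<kappa>" by (rule box) (use w in simp)
    have "measure lborel (Delta \<eta> \<kappa>) > 0"
      using mass_linear_moment_identity(1)[OF bd simple lin[OF \<kappa>ch]]
      by (simp add: closed_Delta borel_closed)
    then have "center_of_mass (Delta \<eta> ?\<kappa>) = w + center_of_mass (Delta \<eta> \<kappa>)"
      using center_of_mass_translate[OF compact_Delta[OF bd]] by (simp add: Delta_translate[symmetric])
    with lin[OF ch] have "h \<bullet> w + h \<bullet> center_of_mass (Delta \<eta> \<kappa>) =
        (\<Sum>k\<in>UNIV. \<gamma> k * (\<kappa> $ k + \<eta> k \<bullet> w)) + (C - c\<^sub>0)" by (simp add: inner_add_right)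
    also have "(\<Sum>k\<in>UNIV. \<gamma> k * (\<kappa> $ k + \<eta> k \<bullet> w)) =
        (\<Sum>k\<in>UNIV. \<gamma> k * \<kappa> $ k) + (\<Sum>k\<in>UNIV. \<gamma> k *\<^sub>R \<eta> k) \<bullet> w"
      by (simp add: distrib_left sum.distrib inner_sum_left)
    finally show ?thesis using lin[OF \<kappa>ch] by simp
  qed
  have "h = (\<Sum>k\<in>UNIV. \<gamma> k *\<^sub>R \<eta> k)"
  proof (rule vector_eq_rdot[THEN iffD1], rule allI)
    fix w
    define r where "r = \<epsilon> / (1 + (\<Sum>k\<in>UNIV. \<bar>\<eta> k \<bullet> w\<bar>))"
    have den: "1 + (\<Sum>k\<in>UNIV. \<bar>\<eta> k \<bullet> w\<bar>) > 0" by (smt (verit) abs_ge_zero sum_nonneg)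
    have rpos: "r > 0" using \<epsilon>pos den by (simp add: r_def)
    have "\<bar>\<eta> k \<bullet> (r *\<^sub>R w)\<bar> \<le> \<epsilon>" for k
    proof -
      have "\<bar>\<eta> k \<bullet> w\<bar> \<le> (\<Sum>k\<in>UNIV. \<bar>\<eta> k \<bullet> w\<bar>)" by (intro member_le_sum) auto
      then have "r * \<bar>\<eta> k \<bullet> w\<bar> \<le> r * (1 + (\<Sum>k\<in>UNIV. \<bar>\<eta> k \<bullet> w\<bar>))"
        using rpos by (intro mult_left_mono) auto
      also have "\<dots> = \<epsilon>" using den by (simp add: r_def)
      finally show ?thesis using rpos by (simp add: abs_mult)
    qed
    from small[OF this] rpos show "h \<bullet> w = (\<Sum>k\<in>UNIV. \<gamma> k *\<^sub>R \<eta> k) \<bullet> w" by simp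
  qed
  from that[OF aff this \<epsilon> mom] show thesis .
qed

context
  fixes \<eta> :: "'n::finite \<Rightarrow> 'a::euclidean_space" and \<kappa> h c \<gamma> \<epsilon>
  assumes simple: "simple_polytope \<eta> \<kappa>" and \<epsilon>: "stable_radius \<eta> \<kappa> \<epsilon>"
    and mom: "\<And>\<kappa>'. (\<And>k. \<bar>\<kappa>' $ k - \<kappa> $ k\<bar> \<le> \<epsilon>) \<Longrightarrow> moment_identity \<eta> h c \<gamma> \<kappa>'"
begin

lemma disjoint_facets_exchange:
  assumes ij: "i \<noteq> j" and disj: "facet \<eta> \<kappa> i \<inter> facet \<eta> \<kappa> j = {}"
    and s: "0 < s" "(real CARD('n) + 2) * s \<le> \<epsilon>" and S: "i \<notin> S" "j \<notin> S"
    and near: "\<And>k. \<bar>\<kappa>' $ k - \<kappa> $ k\<bar> \<le> s"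
  shows "\<gamma> i * measure lebesgue (slab \<eta> \<kappa>' (insert j S) s) +
         \<gamma> j * measure lebesgue (slab \<eta> \<kappa>' (insert i S) s) = 0"
proof (rule moment_exchange[OF simple_polytope_bounded_all[OF simple] s(1) ij _ mom finite S, of \<kappa> \<epsilon>])
  have "card S \<le> CARD('n)" by (simp add: card_mono)
  then have "(real (card S) + 2) * s \<le> (real CARD('n) + 2) * s" using s(1) by (intro mult_right_mono) auto
  then have "(real (card S) + 2) * s \<le> \<epsilon>" using s(2) by linarith
  then have le: "s \<le> \<epsilon> - (real (card S) + 1) * s" by (simp add: algebra_simps)
  show "\<bar>\<kappa>' $ k - \<kappa> $ k\<bar> \<le> \<epsilon> - (real (card S) + 1) * s" for k using near[of k] le by linarith
  show "slab \<eta> \<kappa>' {i, j} s = {}" if "\<And>k. \<bar>\<kappa>' $ k - \<kappa> $ k\<bar> \<le> \<epsilon> - s" for \<kappa>'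
    by (rule stable_slab_empty[OF \<epsilon> disj s(1) _ _ that]) auto
qed

text \<open>
  A step that can be used for all \<open>S\<close>: the differences in the directions of \<open>S\<close>, \<open>i\<close> and \<open>j\<close> stay in the
  box of radius \<open>\<epsilon>\<close> around \<open>\<kappa>\<close>.
\<close>

lemma small_step: "\<epsilon> / (real CARD('n) + 2) > 0" "s \<le> \<epsilon> / (real CARD('n) + 2) \<Longrightarrow> (real CARD('n) + 2) * s \<le> \<epsilon>"
  using \<epsilon> by (auto simp: stable_radius_def field_simps)

text \<open>
  The exchange identity for \<open>S = {}\<close>, in which both volumes are positive.
\<close>

lemma disjoint_facets_opposite_signs:
  assumes ij: "i \<noteq> j" and disj: "facet \<eta> \<kappa> i \<inter> facet \<eta> \<kappa> j = {}" and i: "\<gamma> i \<noteq> 0"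
  shows "\<gamma> i * \<gamma> j < 0"
proof -
  have pos: "\<exists>t>0. \<forall>s. 0 < s \<and> s \<le> t \<longrightarrow> measure lebesgue (slab \<eta> \<kappa> {k} s) > 0" for k
  proof -
    obtain v where v: "v extreme_point_of Delta \<eta> \<kappa>" "k \<in> active \<eta> \<kappa> v"
      using simple_facet_vertex[OF simple] by blast
    show ?thesis by (rule slab_measure_pos[OF simple v(1), of "{k}"]) (use v(2) in blast)+
  qed
  obtain t\<^sub>1 t\<^sub>2 where t: "t\<^sub>1 > 0" "\<And>s. 0 < s \<Longrightarrow> s \<le> t\<^sub>1 \<Longrightarrow> measure lebesgue (slab \<eta> \<kappa> {i} s) > 0"
    "t\<^sub>2 > 0" "\<And>s. 0 < s \<Longrightarrow> s \<le> t\<^sub>2 \<Longrightarrow> measure lebesgue (slab \<eta> \<kappa> {j} s) > 0"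
    using pos[of i] pos[of j] by blast
  define s where "s = min (\<epsilon> / (real CARD('n) + 2)) (min t\<^sub>1 t\<^sub>2)"
  have s: "0 < s" using t small_step by (simp add: s_def)
  define A B where "A = measure lebesgue (slab \<eta> \<kappa> {i} s)" and "B = measure lebesgue (slab \<eta> \<kappa> {j} s)"
  have AB: "A > 0" "B > 0" using t(2)[OF s] t(4)[OF s] by (auto simp: s_def A_def B_def)
  have "(real CARD('n) + 2) * s \<le> \<epsilon>" by (rule small_step) (simp add: s_def)
  then have "\<gamma> i * B + \<gamma> j * A = 0"
    using disjoint_facets_exchange[OF ij disj s, of "{}" \<kappa>] s by (simp add: A_def B_def)
  then have "\<gamma> j = - (\<gamma> i * B / A)" using AB by (simp add: field_simps)
  then have "\<gamma> i * \<gamma> j = - (\<gamma> i * \<gamma> i * B / A)" by simp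
  also have "\<dots> < 0"
  proof -
    have "\<gamma> i * \<gamma> i > 0" using i by (auto simp: zero_less_mult_iff linorder_neq_iff)
    then show ?thesis using AB by simp
  qed
  finally show ?thesis .
qed

text \<open>
  Apart from an asymmetric facet \<open>i\<close> and a facet \<open>j\<close> disjoint from it, all facets are parallel to one
  line. A third facet \<open>k\<close> disjoint from \<open>i\<close> is impossible: \<open>\<gamma> j\<close> and \<open>\<gamma> k\<close> both have the sign opposite
  to \<open>\<gamma> i\<close>, so \<open>j\<close> and \<open>k\<close> must meet; but the exchange identity for \<open>i\<close>, \<open>j\<close> and \<open>S = {k}\<close> makes the
  volume of \<open>slab \<eta> \<kappa> {j, k} s\<close> vanish.
\<close>

lemma asymmetric_facet_direction:
  assumes ij: "i \<noteq> j" and disj: "facet \<eta> \<kappa> i \<inter> facet \<eta> \<kappa> j = {}" and i: "\<gamma> i \<noteq> 0"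
  obtains \<xi> where "\<eta> i \<bullet> \<xi> = 1" "\<And>k. k \<noteq> i \<Longrightarrow> k \<noteq> j \<Longrightarrow> \<eta> k \<bullet> \<xi> = 0"
proof -
  have opp: "\<gamma> i * \<gamma> j < 0" by (rule disjoint_facets_opposite_signs[OF ij disj i])
  then have j: "\<gamma> j \<noteq> 0" by auto
  have eq: "measure lebesgue (slab \<eta> (\<kappa> + axis i s) S s) = measure lebesgue (slab \<eta> \<kappa> S s)"
    if v: "v \<in> Delta \<eta> \<kappa>" "S \<subseteq> active \<eta> \<kappa> v" and iS: "i \<in> S" and s: "0 < s" "s \<le> \<epsilon> / (real CARD('n) + 2)" for S s v
  proof -
    have jS: "j \<notin> S"
    proof
      assume "j \<in> S"
      with v iS have "v \<in> facet \<eta> \<kappa> i \<inter> facet \<eta> \<kappa> j" by (auto simp: mem_facet active_def)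
      with disj show False by blast
    qed
    \<comment> \<open>The exchange identity trades the difference in direction \<open>i\<close> for one in direction \<open>j\<close>, whose further
      difference in direction \<open>i\<close> is zero because the facets are disjoint.\<close>
    define R where "R = S - {i}"
    have R: "S = insert i R" "i \<notin> R" "j \<notin> R" using iS jS by (auto simp: R_def)
    have sb: "(real CARD('n) + 2) * s \<le> \<epsilon>" using small_step s by blast
    have near: "\<bar>\<kappa> $ k - \<kappa> $ k\<bar> \<le> s" "\<bar>(\<kappa> + axis i s) $ k - \<kappa> $ k\<bar> \<le> s" for k
      using s by (auto simp: axis_def)
    note ex = disjoint_facets_exchange[OF ij disj s(1) sb R(2,3)]
    have "(real CARD('n) + 1) * s \<ge> 0" using s(1) by simp
    then have "s \<le> \<epsilon>" using sb by (simp add: algebra_simps)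
    then have "slab \<eta> \<kappa> (insert i (insert j R)) s = {}"
      by (intro stable_slab_empty[OF \<epsilon> disj s(1)]) auto
    moreover have "i \<notin> insert j R" using ij R by blast
    ultimately have "measure lebesgue (slab \<eta> (\<kappa> + axis i s) (insert j R) s) =
        measure lebesgue (slab \<eta> \<kappa> (insert j R) s)"
      using slab_insert[OF simple_polytope_bounded_all[OF simple], of i "insert j R" s \<kappa>] s(1) by simp
    then have "\<gamma> j * measure lebesgue (slab \<eta> (\<kappa> + axis i s) (insert i R) s) =
          \<gamma> j * measure lebesgue (slab \<eta> \<kappa> (insert i R) s)"
      using ex[OF near(1)] ex[OF near(2)] by (metis add_left_cancel)
    then show ?thesis using j by (simp add: R(1))
  qed
  obtain \<xi> where \<xi>: "\<eta> i \<bullet> \<xi> = 1"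
    "\<And>k. k \<noteq> i \<Longrightarrow> facet \<eta> \<kappa> i \<inter> facet \<eta> \<kappa> k \<noteq> {} \<Longrightarrow> \<eta> k \<bullet> \<xi> = 0"
    by (rule flat_facet[OF simple \<epsilon> small_step(1), of i]) (use eq in auto)
  show thesis
  proof (rule that[OF \<xi>(1)])
    fix k assume k: "k \<noteq> i" "k \<noteq> j"
    show "\<eta> k \<bullet> \<xi> = 0"
    proof (cases "facet \<eta> \<kappa> i \<inter> facet \<eta> \<kappa> k = {}")
      case False then show ?thesis by (rule \<xi>(2)[OF k(1)])
    next
      case ik: True
      have oppk: "\<gamma> i * \<gamma> k < 0" by (rule disjoint_facets_opposite_signs[OF k(1)[symmetric] ik i])
      have False
      proof (cases "facet \<eta> \<kappa> j \<inter> facet \<eta> \<kappa> k = {}")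
        case True
        from disjoint_facets_opposite_signs[OF k(2)[symmetric] True j] opp oppk
        show False by (auto simp: mult_less_0_iff)
      next
        case False
        then obtain x where "x \<in> facet \<eta> \<kappa> j \<inter> facet \<eta> \<kappa> k" by blast
        then have "x \<in> Delta \<eta> \<kappa>" "{j, k} \<subseteq> active \<eta> \<kappa> x" by (auto simp: mem_facet active_def)
        then obtain v where v: "v extreme_point_of Delta \<eta> \<kappa>" "{j, k} \<subseteq> active \<eta> \<kappa> v"
          using vertex_on_face[OF simple_polytope_bounded_all[OF simple]] by blast
        obtain t where t: "t > 0" "\<And>s. 0 < s \<Longrightarrow> s \<le> t \<Longrightarrow> measure lebesgue (slab \<eta> \<kappa> {j, k} s) > 0"
          using slab_measure_pos[OF simple v] by blast
        define s where "s = min (\<epsilon> / (real CARD('n) + 2)) t"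
        have s: "0 < s" "s \<le> t" using t(1) small_step(1) by (auto simp: s_def)
        have sb: "(real CARD('n) + 2) * s \<le> \<epsilon>" by (rule small_step) (simp add: s_def)
        have "(real CARD('n) + 1) * s \<ge> 0" using s(1) by simp
        then have "s \<le> \<epsilon>" using sb by (simp add: algebra_simps)
        then have "slab \<eta> \<kappa> {i, k} s = {}" by (intro stable_slab_empty[OF \<epsilon> ik s(1)]) auto
        moreover have "\<gamma> i * measure lebesgue (slab \<eta> \<kappa> {j, k} s) + \<gamma> j * measure lebesgue (slab \<eta> \<kappa> {i, k} s) = 0"
          by (rule disjoint_facets_exchange[OF ij disj s(1) sb]) (use k s(1) in auto)
        ultimately show False using t(2)[OF s] i by simp
      qed
      then show ?thesis ..
    qed
  qed
qed

text \<open>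
  Moving the wall \<open>i\<close> outwards gives a translate of the polytope with the wall \<open>j\<close> moved outwards, so
  both changes of volume in the exchange identity agree.
\<close>

lemma opposite_coefficients:
  assumes ij: "i \<noteq> j" and disj: "facet \<eta> \<kappa> i \<inter> facet \<eta> \<kappa> j = {}"
    and \<xi>: "\<eta> i \<bullet> \<xi> = 1" "\<eta> j \<bullet> \<xi> = -1" "\<And>k. k \<noteq> i \<Longrightarrow> k \<noteq> j \<Longrightarrow> \<eta> k \<bullet> \<xi> = 0"
  shows "\<gamma> i + \<gamma> j = 0"
proof -
  obtain v where v: "v extreme_point_of Delta \<eta> \<kappa>" "i \<in> active \<eta> \<kappa> v"
    using simple_facet_vertex[OF simple] by blast
  then obtain t where t: "t > 0" "\<And>s. 0 < s \<Longrightarrow> s \<le> t \<Longrightarrow> measure lebesgue (slab \<eta> \<kappa> {i} s) > 0"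
    using slab_measure_pos[OF simple v(1), of "{i}"] by blast
  define s where "s = min (\<epsilon> / (real CARD('n) + 2)) t"
  have s: "0 < s" "s \<le> t" using t(1) small_step(1) by (auto simp: s_def)
  have sb: "(real CARD('n) + 2) * s \<le> \<epsilon>" by (rule small_step) (simp add: s_def)
  have "\<kappa> + axis i s = (\<chi> k. (\<kappa> + axis j s) $ k + \<eta> k \<bullet> (s *\<^sub>R \<xi>))"
    using \<xi> ij unfolding vec_eq_iff axis_def by auto
  then have "Delta \<eta> (\<kappa> + axis i s) = (+) (s *\<^sub>R \<xi>) ` Delta \<eta> (\<kappa> + axis j s)"
    by (simp add: Delta_translate)
  then have "measure lebesgue (Delta \<eta> (\<kappa> + axis i s)) = measure lebesgue (Delta \<eta> (\<kappa> + axis j s))"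
    by (simp add: measure_translation)
  then have "measure lebesgue (slab \<eta> \<kappa> {i} s) = measure lebesgue (slab \<eta> \<kappa> {j} s)"
    using slab_insert[OF simple_polytope_bounded_all[OF simple], of i "{}" s \<kappa>]
      slab_insert[OF simple_polytope_bounded_all[OF simple], of j "{}" s \<kappa>] s(1) by simp
  moreover have "\<gamma> i * measure lebesgue (slab \<eta> \<kappa> {j} s) + \<gamma> j * measure lebesgue (slab \<eta> \<kappa> {i} s) = 0"
    using disjoint_facets_exchange[OF ij disj s(1) sb, of "{}" \<kappa>] s(1) by simp
  ultimately have "(\<gamma> i + \<gamma> j) * measure lebesgue (slab \<eta> \<kappa> {i} s) = 0" by (simp add: algebra_simps)
  then show ?thesis using t(2)[OF s] by simp
qed

end

section \<open>Robust symmetries and equivalent facets\<close>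

lemma parallel_facets_opposite_sides:
  fixes \<eta> :: "'n::finite \<Rightarrow> 'a::euclidean_space"
  assumes simple: "simple_polytope \<eta> \<kappa>"
    and \<xi>: "\<eta> i \<bullet> \<xi> = 1" "\<And>k. k \<noteq> i \<Longrightarrow> k \<noteq> j \<Longrightarrow> \<eta> k \<bullet> \<xi> = 0"
  shows "\<eta> j \<bullet> \<xi> < 0"
proof (rule ccontr)
  assume "\<not> ?thesis"
  then have "\<eta> k \<bullet> (- \<xi>) \<le> 0" for k using \<xi> by (cases "k = i"; cases "k = j") auto
  then have "- \<xi> = 0"
    by (rule recession_direction_zero[OF simple_polytope_bounded[OF simple] simple_polytope_nonempty[OF simple]])
  with \<xi>(1) show False by simp
qed

text \<open>
  Two symmetries with the same linear part differ by a translation, and no translation other than the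
  identity maps a nonempty bounded set into itself.
\<close>

lemma symmetry_unique:
  fixes S :: "'a::euclidean_space set"
  assumes S: "bounded S" "S \<noteq> {}"
    and a: "symmetry_of a S" "affine_with_linear_part a L"
    and b: "symmetry_of b S" "affine_with_linear_part b L"
  shows "a = b"
proof -
  obtain w\<^sub>1 w\<^sub>2 where w: "\<And>x. a x = L x + w\<^sub>1" "\<And>x. b x = L x + w\<^sub>2"
    using a b by (auto simp: affine_with_linear_part_def)
  define w where "w = w\<^sub>1 - w\<^sub>2"
  have ab: "a x = b x + w" for x by (simp add: w w_def)
  have step: "x + w \<in> S" if "x \<in> S" for x
  proof -
    have "x \<in> b ` S" using b(1) that by (simp add: symmetry_of_def)
    then obtain y where "y \<in> S" "x = b y" by blast
    then have "x + w = a y" by (simp add: ab)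
    then show ?thesis using a(1) \<open>y \<in> S\<close> by (auto simp: symmetry_of_def)
  qed
  obtain x where x: "x \<in> S" using S by blast
  have "x + real m *\<^sub>R w \<in> S" for m
  proof (induction m)
    case (Suc m)
    then show ?case using step[OF Suc] by (simp add: algebra_simps)
  qed (use x in simp)
  moreover obtain B where B: "\<And>y. y \<in> S \<Longrightarrow> norm y \<le> B" using S(1) by (auto simp: bounded_iff)
  ultimately have le: "norm (x + real m *\<^sub>R w) \<le> B" for m by blast
  have "w = 0"
  proof (rule ccontr)
    assume "w \<noteq> 0"
    then obtain m where "B + norm x < real m * norm w"
      using ex_less_of_nat_mult[of "norm w" "B + norm x"] by auto
    moreover have "real m * norm w \<le> norm (x + real m *\<^sub>R w) + norm x"
      using norm_diff_ineq[of "real m *\<^sub>R w" x] by (simp add: add.commute)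
    ultimately show False using le[of m] by simp
  qed
  then show ?thesis using ab by auto
qed

text \<open>
  By uniqueness of the symmetry with a given linear part, the universal quantifier over symmetries in
  the definition of equivalence may be replaced by an existential one.
\<close>

lemma equivalent_facets_iff:
  fixes \<eta> :: "'n::finite \<Rightarrow> 'a::euclidean_space"
  shows "equivalent_facets \<eta> \<kappa> i j \<longleftrightarrow>
    (\<exists>L. linear L \<and> (\<forall>\<kappa>'\<in>chamber \<eta> \<kappa>. \<exists>a. symmetry_of a (Delta \<eta> \<kappa>') \<and>
       affine_with_linear_part a L \<and> a ` facet \<eta> \<kappa>' i = facet \<eta> \<kappa>' j))" (is "_ \<longleftrightarrow> ?R")
proof
  assume ?R
  then obtain L where L: "linear L" and ex: "\<And>\<kappa>'. \<kappa>' \<in> chamber \<eta> \<kappa> \<Longrightarrow>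
      \<exists>a. symmetry_of a (Delta \<eta> \<kappa>') \<and> affine_with_linear_part a L \<and> a ` facet \<eta> \<kappa>' i = facet \<eta> \<kappa>' j"
    by auto
  have "a ` facet \<eta> \<kappa>' i = facet \<eta> \<kappa>' j"
    if \<kappa>': "\<kappa>' \<in> chamber \<eta> \<kappa>" and a: "symmetry_of a (Delta \<eta> \<kappa>')" "affine_with_linear_part a L" for \<kappa>' a
  proof -
    obtain b where b: "symmetry_of b (Delta \<eta> \<kappa>')" "affine_with_linear_part b L"
      "b ` facet \<eta> \<kappa>' i = facet \<eta> \<kappa>' j" using ex[OF \<kappa>'] by auto
    have sp: "simple_polytope \<eta> \<kappa>'" using \<kappa>' by (rule simple_polytope_chamber)
    have "a = b"
      by (rule symmetry_unique[OF simple_polytope_bounded[OF sp] simple_polytope_nonempty[OF sp] a b(1,2)])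
    with b(3) show ?thesis by simp
  qed
  moreover have "robust_symmetry \<eta> \<kappa> L" unfolding robust_symmetry_def using L ex by metis
  ultimately show "equivalent_facets \<eta> \<kappa> i j"
    unfolding equivalent_facets_def by (intro exI[of _ L]) auto
next
  assume "equivalent_facets \<eta> \<kappa> i j"
  then show ?R unfolding equivalent_facets_def robust_symmetry_def by metis
qed

lemma equivalent_facets_trans:
  fixes \<eta> :: "'n::finite \<Rightarrow> 'a::euclidean_space"
  assumes "equivalent_facets \<eta> \<kappa> i j" "equivalent_facets \<eta> \<kappa> j k"
  shows "equivalent_facets \<eta> \<kappa> i k"
proof -
  obtain L where L: "linear L"
    "\<And>\<kappa>'. \<kappa>' \<in> chamber \<eta> \<kappa> \<Longrightarrow> \<exists>a. symmetry_of a (Delta \<eta> \<kappa>') \<and> affine_with_linear_part a L \<and>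
          a ` facet \<eta> \<kappa>' i = facet \<eta> \<kappa>' j"
    using assms(1) unfolding equivalent_facets_iff by auto
  obtain M where M: "linear M"
    "\<And>\<kappa>'. \<kappa>' \<in> chamber \<eta> \<kappa> \<Longrightarrow> \<exists>a. symmetry_of a (Delta \<eta> \<kappa>') \<and> affine_with_linear_part a M \<and>
          a ` facet \<eta> \<kappa>' j = facet \<eta> \<kappa>' k"
    using assms(2) unfolding equivalent_facets_iff by auto
  have lin: "linear (M \<circ> L)" using L(1) M(1) by (rule linear_compose)
  have "\<exists>a. symmetry_of a (Delta \<eta> \<kappa>') \<and> affine_with_linear_part a (M \<circ> L) \<and>
          a ` facet \<eta> \<kappa>' i = facet \<eta> \<kappa>' k" if \<kappa>': "\<kappa>' \<in> chamber \<eta> \<kappa>" for \<kappa>'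
  proof -
    obtain a where a: "symmetry_of a (Delta \<eta> \<kappa>')" "affine_with_linear_part a L"
      "a ` facet \<eta> \<kappa>' i = facet \<eta> \<kappa>' j" using L(2)[OF \<kappa>'] by auto
    obtain b where b: "symmetry_of b (Delta \<eta> \<kappa>')" "affine_with_linear_part b M"
      "b ` facet \<eta> \<kappa>' j = facet \<eta> \<kappa>' k" using M(2)[OF \<kappa>'] by auto
    obtain w\<^sub>1 w\<^sub>2 where "\<And>x. a x = L x + w\<^sub>1" "\<And>x. b x = M x + w\<^sub>2"
      using a(2) b(2) by (auto simp: affine_with_linear_part_def)
    then have "(b \<circ> a) x = (M \<circ> L) x + (M w\<^sub>1 + w\<^sub>2)" for x
      using M(1) by (simp add: linear_add)
    then have aff: "affine_with_linear_part (b \<circ> a) (M \<circ> L)"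
      using lin unfolding affine_with_linear_part_def by auto
    moreover have "(b \<circ> a) ` Delta \<eta> \<kappa>' = Delta \<eta> \<kappa>'"
      using a(1) b(1) unfolding symmetry_of_def image_comp[symmetric] by simp
    then have "symmetry_of (b \<circ> a) (Delta \<eta> \<kappa>')"
      using aff unfolding symmetry_of_def by auto
    moreover have "(b \<circ> a) ` facet \<eta> \<kappa>' i = facet \<eta> \<kappa>' k"
      using a(3) b(3) unfolding image_comp[symmetric] by simp
    ultimately show ?thesis by (intro exI[of _ "b \<circ> a"] conjI)
  qed
  then show ?thesis unfolding equivalent_facets_iff using lin by (intro exI[of _ "M \<circ> L"]) simp
qed

text \<open>
  If all facets other than \<open>i\<close> and \<open>j\<close> are parallel to \<open>\<xi>\<close>, the map \<open>L\<close> is the linear part of the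
  reflection of every segment in direction \<open>\<xi>\<close> between the walls \<open>i\<close> and \<open>j\<close> in its midpoint.
\<close>

lemma reflection_robust_symmetry:
  fixes \<eta> :: "'n::finite \<Rightarrow> 'a::euclidean_space"
  assumes ij: "i \<noteq> j" and \<xi>: "\<eta> i \<bullet> \<xi> = 1" "\<eta> j \<bullet> \<xi> = - \<rho>" "\<rho> > 0"
    "\<And>k. k \<noteq> i \<Longrightarrow> k \<noteq> j \<Longrightarrow> \<eta> k \<bullet> \<xi> = 0"
  defines "L \<equiv> \<lambda>x. x + ((\<eta> j \<bullet> x) / \<rho> - \<eta> i \<bullet> x) *\<^sub>R \<xi>"
  shows "robust_symmetry \<eta> \<kappa> L" "equivalent_facets \<eta> \<kappa> i j" "adjoint L (\<eta> i) = \<eta> j /\<^sub>R \<rho>"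
proof -
  have lin: "linear L" unfolding L_def
    by (rule linearI) (auto simp: inner_add_right add_divide_distrib algebra_simps diff_divide_distrib)
  define a where "a \<kappa>' x = L x + ((\<kappa>' $ i - \<kappa>' $ j / \<rho>) *\<^sub>R \<xi>)" for \<kappa>' :: "real ^ 'n" and x
  have aff: "affine_with_linear_part (a \<kappa>') L" for \<kappa>'
    unfolding affine_with_linear_part_def using lin a_def by blast
  have ai: "\<eta> i \<bullet> a \<kappa>' x - \<kappa>' $ i = (\<eta> j \<bullet> x - \<kappa>' $ j) / \<rho>" for \<kappa>' x
    using \<xi> by (simp add: a_def L_def inner_add_right diff_divide_distrib)
  have aj: "\<eta> j \<bullet> a \<kappa>' x - \<kappa>' $ j = \<rho> * (\<eta> i \<bullet> x - \<kappa>' $ i)" for \<kappa>' x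
    using \<xi> by (simp add: a_def L_def inner_add_right field_simps)
  have ak: "\<eta> k \<bullet> a \<kappa>' x = \<eta> k \<bullet> x" if "k \<noteq> i" "k \<noteq> j" for k \<kappa>' x
    using \<xi>(4)[OF that] by (simp add: a_def L_def inner_add_right)
  have aa: "a \<kappa>' (a \<kappa>' x) = x" for \<kappa>' x
  proof -
    have e: "a \<kappa>' z = z + ((\<eta> j \<bullet> z - \<kappa>' $ j) / \<rho> - (\<eta> i \<bullet> z - \<kappa>' $ i)) *\<^sub>R \<xi>" for z
      by (simp add: a_def L_def algebra_simps diff_divide_distrib)
    have "a \<kappa>' (a \<kappa>' x) = a \<kappa>' x + ((\<eta> j \<bullet> a \<kappa>' x - \<kappa>' $ j) / \<rho> - (\<eta> i \<bullet> a \<kappa>' x - \<kappa>' $ i)) *\<^sub>R \<xi>"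
      by (rule e)
    also have "\<dots> = a \<kappa>' x + ((\<eta> i \<bullet> x - \<kappa>' $ i) - (\<eta> j \<bullet> x - \<kappa>' $ j) / \<rho>) *\<^sub>R \<xi>"
      unfolding ai aj using \<xi>(3) by simp
    also have "\<dots> = x" unfolding e[of x] by (simp add: algebra_simps)
    finally show ?thesis .
  qed
  have aD: "a \<kappa>' x \<in> Delta \<eta> \<kappa>'" if "x \<in> Delta \<eta> \<kappa>'" for \<kappa>' x
    unfolding mem_Delta
  proof
    fix k
    have x: "\<eta> k \<bullet> x \<le> \<kappa>' $ k" "\<eta> i \<bullet> x - \<kappa>' $ i \<le> 0" "\<eta> j \<bullet> x - \<kappa>' $ j \<le> 0" using that by (auto simp: mem_Delta)
    have "(\<eta> j \<bullet> x - \<kappa>' $ j) / \<rho> \<le> 0" "\<rho> * (\<eta> i \<bullet> x - \<kappa>' $ i) \<le> 0"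
      using x \<xi>(3) by (auto simp: divide_le_0_iff mult_le_0_iff)
    then show "\<eta> k \<bullet> a \<kappa>' x \<le> \<kappa>' $ k"
      using ai[of \<kappa>' x] aj[of \<kappa>' x] ak[of k \<kappa>' x] x(1) by (cases "k = i"; cases "k = j") auto
  qed
  have img: "a \<kappa>' ` A = B" if "\<And>x. x \<in> A \<Longrightarrow> a \<kappa>' x \<in> B" "\<And>x. x \<in> B \<Longrightarrow> a \<kappa>' x \<in> A" for A B \<kappa>'

  proof (intro equalityI subsetI)
    fix y assume "y \<in> B"
    then show "y \<in> a \<kappa>' ` A" using that(2) aa[of \<kappa>' y] by (intro image_eqI[of _ _ "a \<kappa>' y"]) auto
  qed (use that(1) in auto)
  have sym: "symmetry_of (a \<kappa>') (Delta \<eta> \<kappa>')" for \<kappa>'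
    unfolding symmetry_of_def using aff[of \<kappa>'] img[of "Delta \<eta> \<kappa>'" \<kappa>' "Delta \<eta> \<kappa>'", OF aD aD] by blast
  have fac: "a \<kappa>' ` facet \<eta> \<kappa>' i = facet \<eta> \<kappa>' j" for \<kappa>'
  proof (rule img)
    show "a \<kappa>' x \<in> facet \<eta> \<kappa>' j" if "x \<in> facet \<eta> \<kappa>' i" for x
      using that aD[of x \<kappa>'] aj[of \<kappa>' x] by (simp add: mem_facet)
    show "a \<kappa>' x \<in> facet \<eta> \<kappa>' i" if "x \<in> facet \<eta> \<kappa>' j" for x
      using that aD[of x \<kappa>'] ai[of \<kappa>' x] by (simp add: mem_facet)
  qed
  show rob: "robust_symmetry \<eta> \<kappa> L" unfolding robust_symmetry_def using lin sym aff by auto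
  show "equivalent_facets \<eta> \<kappa> i j" unfolding equivalent_facets_iff
  proof (rule exI[of _ L], intro conjI ballI lin)
    fix \<kappa>' :: "real ^ 'n"
    show "\<exists>a. symmetry_of a (Delta \<eta> \<kappa>') \<and> affine_with_linear_part a L \<and> a ` facet \<eta> \<kappa>' i = facet \<eta> \<kappa>' j"
      using sym[of \<kappa>'] aff[of \<kappa>'] fac[of \<kappa>'] by (intro exI[of _ "a \<kappa>'"] conjI)
  qed
  show "adjoint L (\<eta> i) = \<eta> j /\<^sub>R \<rho>"
  proof (rule vector_eq_ldot[THEN iffD1], rule allI)
    fix x
    have "x \<bullet> adjoint L (\<eta> i) = L x \<bullet> \<eta> i" by (rule adjoint_works[OF lin])
    also have "L x \<bullet> \<eta> i = \<eta> i \<bullet> L x" by (rule inner_commute)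
    also have "\<dots> = (\<eta> j \<bullet> x) / \<rho>" using \<xi>(1) by (simp add: L_def inner_add_right)
    also have "\<dots> = x \<bullet> (\<eta> j /\<^sub>R \<rho>)" by (simp add: inner_commute divide_inverse mult.commute)
    finally show "x \<bullet> adjoint L (\<eta> i) = x \<bullet> (\<eta> j /\<^sub>R \<rho>)" .
  qed
qed

section \<open>Mass linear functions without pervasive facets\<close>

theorem proposition1p19:
  fixes \<eta> :: "'n::finite \<Rightarrow> 'a::euclidean_space" and \<kappa> :: "real ^ 'n"
  assumes "simple_polytope \<eta> \<kappa>"
    and "normalized_conormals \<eta> \<kappa>"
    and "\<not> (\<exists>i. pervasive_facet \<eta> \<kappa> i)"
  shows "\<forall>H :: 'a \<Rightarrow> real. mass_linear \<eta> \<kappa> H \<longrightarrow> inessential \<eta> \<kappa> H"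
proof (intro allI impI)
  fix H :: "'a \<Rightarrow> real" assume ml: "mass_linear \<eta> \<kappa> H"
  obtain h \<gamma> c \<epsilon> where aff: "affine_with_linear_part H (\<lambda>x. h \<bullet> x)"
    and h: "h = (\<Sum>k\<in>UNIV. \<gamma> k *\<^sub>R \<eta> k)" and \<epsilon>: "stable_radius \<eta> \<kappa> \<epsilon>"
    and mom: "\<And>\<kappa>'. (\<And>k. \<bar>\<kappa>' $ k - \<kappa> $ k\<bar> \<le> \<epsilon>) \<Longrightarrow> moment_identity \<eta> h c \<gamma> \<kappa>'"
  proof (rule mass_linear_data[OF assms(1) ml])
    fix h \<gamma> c \<epsilon>
    assume *: "affine_with_linear_part H (\<lambda>x. h \<bullet> x)" "h = (\<Sum>k\<in>UNIV. \<gamma> k *\<^sub>R \<eta> k)"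
      "stable_radius \<eta> \<kappa> \<epsilon>" "\<And>\<kappa>'. (\<And>k. \<bar>\<kappa>' $ k - \<kappa> $ k\<bar> \<le> \<epsilon>) \<Longrightarrow> moment_identity \<eta> h c \<gamma> \<kappa>'"
    show thesis by (rule that[OF *])
  qed
  have "\<exists>j. j \<noteq> i \<and> facet \<eta> \<kappa> i \<inter> facet \<eta> \<kappa> j = {}" for i
    using assms(3) unfolding pervasive_facet_def by auto
  then obtain P where P: "\<And>i. P i \<noteq> i" "\<And>i. facet \<eta> \<kappa> i \<inter> facet \<eta> \<kappa> (P i) = {}" by metis
  \<comment> \<open>On asymmetric facets, \<open>P\<close> is a fixed-point free involution that preserves classes and negates \<open>\<gamma>\<close>.\<close>
  have partner: "equivalent_facets \<eta> \<kappa> i (P i) \<and> \<gamma> (P i) = - \<gamma> i \<and> P (P i) = i" if i: "\<gamma> i \<noteq> 0" for i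
  proof -
    let ?j = "P i"
    obtain \<xi> where \<xi>: "\<eta> i \<bullet> \<xi> = 1" "\<And>k. k \<noteq> i \<Longrightarrow> k \<noteq> ?j \<Longrightarrow> \<eta> k \<bullet> \<xi> = 0"
    proof (rule asymmetric_facet_direction[where \<gamma> = \<gamma>, OF assms(1) \<epsilon> _ P(1)[of i, symmetric] P(2)[of i]])
      show "moment_identity \<eta> h c \<gamma> \<kappa>'" if "\<And>k. \<bar>\<kappa>' $ k - \<kappa> $ k\<bar> \<le> \<epsilon>" for \<kappa>' by (rule mom[OF that])
      show "\<gamma> i \<noteq> 0" by (rule i)
      fix \<xi> assume "\<eta> i \<bullet> \<xi> = 1" "\<And>k. k \<noteq> i \<Longrightarrow> k \<noteq> ?j \<Longrightarrow> \<eta> k \<bullet> \<xi> = 0"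
      then show thesis by (rule that)
    qed
    define \<rho> where "\<rho> = - (\<eta> ?j \<bullet> \<xi>)"
    have \<rho>: "\<rho> > 0" "\<eta> ?j \<bullet> \<xi> = - \<rho>"
      using parallel_facets_opposite_sides[OF assms(1) \<xi>] by (auto simp: \<rho>_def)
    note mirror = reflection_robust_symmetry[OF P(1)[of i, symmetric] \<xi>(1) \<rho>(2,1) \<xi>(2)]
    \<comment> \<open>The normalized conormal \<open>\<eta> j /\<^sub>R \<rho>\<close> can only be \<open>\<eta> j\<close> itself, since \<open>\<xi>\<close> separates it from all others.\<close>
    obtain m where m: "\<eta> ?j /\<^sub>R \<rho> = \<eta> m"
      using assms(2)[unfolded normalized_conormals_def, rule_format, OF mirror(1), of i] mirror(3) by auto
    have m\<xi>: "\<eta> m \<bullet> \<xi> = -1" using \<rho> by (simp add: m[symmetric])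
    then have "m = ?j" using \<xi>(1) \<xi>(2)[of m] by (cases "m = i") auto
    with m\<xi> have "\<eta> ?j \<bullet> \<xi> = -1" by simp
    have "\<gamma> i + \<gamma> ?j = 0"
    proof (rule opposite_coefficients[where \<gamma> = \<gamma>, OF assms(1) \<epsilon> _ P(1)[of i, symmetric] P(2)[of i] \<xi>(1) \<open>\<eta> ?j \<bullet> \<xi> = -1\<close>])
      show "moment_identity \<eta> h c \<gamma> \<kappa>'" if "\<And>k. \<bar>\<kappa>' $ k - \<kappa> $ k\<bar> \<le> \<epsilon>" for \<kappa>' by (rule mom[OF that])
    qed (rule \<xi>(2))
    then have neg: "\<gamma> ?j = - \<gamma> i" by simp
    have "P ?j = i"
    proof (rule ccontr)
      assume ne: "P ?j \<noteq> i"
      let ?k = "P ?j"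
      have k\<xi>: "\<eta> ?k \<bullet> \<xi> = 0" using \<xi>(2)[OF ne P(1)] .
      obtain x where x: "x \<in> facet \<eta> \<kappa> ?k" using simple_facet_nonempty[OF assms(1)] by blast
      \<comment> \<open>Moving a point of the facet \<open>P j\<close> along \<open>- \<xi>\<close> until it hits the wall \<open>j\<close> stays on the facet \<open>P j\<close>.\<close>
      define r where "r = (\<kappa> $ ?j - \<eta> ?j \<bullet> x) / \<rho>"
      have r: "r \<ge> 0" "r * \<rho> = \<kappa> $ ?j - \<eta> ?j \<bullet> x" using x \<rho> by (auto simp: r_def mem_facet mem_Delta)
      have "x - r *\<^sub>R \<xi> \<in> Delta \<eta> \<kappa>" unfolding mem_Delta
      proof
        fix l
        have "\<eta> l \<bullet> x \<le> \<kappa> $ l" using x by (simp add: mem_facet mem_Delta)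
        then show "\<eta> l \<bullet> (x - r *\<^sub>R \<xi>) \<le> \<kappa> $ l"
          using \<xi> \<rho> r by (cases "l = i"; cases "l = ?j") (auto simp: inner_diff_right)
      qed
      then have "x - r *\<^sub>R \<xi> \<in> facet \<eta> \<kappa> ?j \<inter> facet \<eta> \<kappa> ?k"
        using x \<rho> r k\<xi> by (auto simp: mem_facet inner_diff_right)
      with P(2)[of ?j] show False by blast
    qed
    with mirror(2) neg show ?thesis by blast
  qed
  have "inessential_vector \<eta> \<kappa> h"
    unfolding inessential_vector_def
  proof (intro exI[of _ \<gamma>] conjI ballI h)
    fix I assume "I \<in> facet_classes \<eta> \<kappa>"
    then obtain e where I: "I = {j. equivalent_facets \<eta> \<kappa> e j}"
      by (auto simp: facet_classes_def quotient_def)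
    let ?A = "{i \<in> I. \<gamma> i \<noteq> 0}"
    have mem: "P i \<in> ?A" if "i \<in> ?A" for i
      using that partner[of i] equivalent_facets_trans[of \<eta> \<kappa> e i "P i"] by (auto simp: I)
    have "bij_betw P ?A ?A"
      by (rule bij_betwI[of _ _ _ P]) (use mem partner in auto)
    then have "(\<Sum>i\<in>?A. \<gamma> i) = (\<Sum>i\<in>?A. \<gamma> (P i))" by (rule sum.reindex_bij_betw[symmetric])
    also have "\<dots> = (\<Sum>i\<in>?A. - \<gamma> i)" using partner by (intro sum.cong) auto
    finally have "(\<Sum>i\<in>?A. \<gamma> i) = 0" by (simp add: sum_negf)
    moreover have "(\<Sum>i\<in>I. \<gamma> i) = (\<Sum>i\<in>?A. \<gamma> i)" by (intro sum.mono_neutral_right) auto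
    ultimately show "(\<Sum>i\<in>I. \<gamma> i) = 0" by simp
  qed
  with aff show "inessential \<eta> \<kappa> H" unfolding inessential_def by blast
qed

end
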